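(* Let $\Xi\subseteq\mathbb{R}^m$ be convex, $\widehat\xi_1,\dots,\widehat\xi_N\in\Xi$, $\widehat{\mathbb P}_N=\frac1N\sum_{i=1}^N\delta_{\widehat\xi_i}$, $\varepsilon\ge 0$, let $\|\cdot\|$ be a norm on $\mathbb{R}^m$ and let $\rho$ be a law-invariant coherent risk measure. If $\ell:\mathbb{R}^m\to\mathbb{R}$ is concave, then the worst-case expectation problem $$\sup_{\Pi}\ \mathbb{E}^{\Pi}[\ell(\xi)]\quad\text{subject to}\quad \rho^{\Pi}(\|\widehat\xi-\xi\|)\le\varepsilon,$$ where $\Pi$ ranges over the probability distributions on $\Xi\times\Xi$ of a pair $(\widehat\xi,\xi)$ whose first marginal is $\widehat{\mathbb P}_N$ (the second marginal $\mathbb P$ being free), is equivalent (same optimal value) to $$\sup_{y_1,\dots,y_N\in\mathbb{R}^m}\ \frac1N\sum_{i=1}^N\ell(y_i)\quad\text{subject to}\quad \rho^{\Pi}(\|\widehat\xi-\xi\|)\le\varepsilon,\quad \Pi\big((\widehat\xi,\xi)=(\widehat\xi_i,y_i)\big)=\tfrac1N,\quad y_i\in\Xi,\quad i=1,\dots,N,$$ i.e. where $(\widehat\xi,\xi)$ has distribution $\Pi=\frac1N\sum_{i=1}^N\delta_{(\widehat\xi_i,y_i)}$.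
   Context: A law-invariant coherent risk measure $\rho$ is a functional on nonnegative random variables (transportation costs) on an atomless probability space, with values in $[0,\infty]$, satisfying $\rho(0)=0$ and: translation invariance $\rho(X+c)=\rho(X)+c$ for $c\ge0$; monotonicity $\rho(X_1)\ge\rho(X_2)$ whenever $X_1\ge X_2$; subadditivity $\rho(X_1+X_2)\le\rho(X_1)+\rho(X_2)$; positive homogeneity $\rho(cX)=c\rho(X)$ for $c>0$; law invariance $\rho(X_1)=\rho(X_2)$ whenever $X_1$ and $X_2$ have the same distribution. $\rho^{\Pi}(\|\widehat\xi-\xi\|)$ denotes the value of $\rho$ on the law of $\|\widehat\xi-\xi\|$ when $(\widehat\xi,\xi)\sim\Pi$. *)

theory Defs
  imports "HOL-Probability.Probability"
begin

definition is_norm :: "('v::real_vector \<Rightarrow> real) \<Rightarrow> bool" where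
  "is_norm nrm \<longleftrightarrow>
     (\<forall>x. nrm x \<ge> 0) \<and> (\<forall>x. nrm x = 0 \<longleftrightarrow> x = 0) \<and>
     (\<forall>c x. nrm (c *\<^sub>R x) = \<bar>c\<bar> * nrm x) \<and>
     (\<forall>x y. nrm (x + y) \<le> nrm x + nrm y)"

locale atomless_prob_space = prob_space M for M :: "'w measure" +
  assumes atomless:
    "A \<in> sets M \<Longrightarrow> emeasure M A > 0 \<Longrightarrow>
       \<exists>B\<in>sets M. B \<subseteq> A \<and> 0 < emeasure M B \<and> emeasure M B < emeasure M A"

definition nonneg_rv :: "'w measure \<Rightarrow> ('w \<Rightarrow> real) set" where
  "nonneg_rv M = {X \<in> borel_measurable M. \<forall>w\<in>space M. X w \<ge> 0}"

(* The inequality in mono is pointwise; its almost sure version follows by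
   law_invariant, since X2 may be changed on a null set. *)
locale law_invariant_coherent_risk_measure = atomless_prob_space M
  for M :: "'w measure" +
  fixes \<rho> :: "('w \<Rightarrow> real) \<Rightarrow> ennreal"
  assumes zero: "\<rho> (\<lambda>_. 0) = 0"
    and translation_invariant:
      "X \<in> nonneg_rv M \<Longrightarrow> c \<ge> 0 \<Longrightarrow> \<rho> (\<lambda>w. X w + c) = \<rho> X + ennreal c"
    and mono:
      "X1 \<in> nonneg_rv M \<Longrightarrow> X2 \<in> nonneg_rv M \<Longrightarrow>
         (\<And>w. w \<in> space M \<Longrightarrow> X1 w \<ge> X2 w) \<Longrightarrow> \<rho> X1 \<ge> \<rho> X2"
    and subadditive:
      "X1 \<in> nonneg_rv M \<Longrightarrow> X2 \<in> nonneg_rv M \<Longrightarrow>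
         \<rho> (\<lambda>w. X1 w + X2 w) \<le> \<rho> X1 + \<rho> X2"
    and positively_homogeneous:
      "X \<in> nonneg_rv M \<Longrightarrow> c > 0 \<Longrightarrow> \<rho> (\<lambda>w. c * X w) = ennreal c * \<rho> X"
    and law_invariant:
      "X1 \<in> nonneg_rv M \<Longrightarrow> X2 \<in> nonneg_rv M \<Longrightarrow>
         distr M borel X1 = distr M borel X2 \<Longrightarrow> \<rho> X1 = \<rho> X2"

(* The value of a law-invariant risk measure on a law mu on [0, infinity). It is well
   defined: on an atomless space every such law is the law of some X in nonneg_rv M,
   and by law invariance rho X does not depend on the choice of X. *)
definition risk_of_law ::
    "'w measure \<Rightarrow> (('w \<Rightarrow> real) \<Rightarrow> ennreal) \<Rightarrow> real measure \<Rightarrow> ennreal" where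
  "risk_of_law M \<rho> \<mu> =
     (THE r. \<exists>X\<in>nonneg_rv M. distr M borel X = \<mu> \<and> r = \<rho> X)"

definition transport_risk ::
    "'w measure \<Rightarrow> (('w \<Rightarrow> real) \<Rightarrow> ennreal) \<Rightarrow> ('v::real_normed_vector \<Rightarrow> real) \<Rightarrow>
       ('v \<times> 'v) measure \<Rightarrow> ennreal" where
  "transport_risk M \<rho> nrm P =
     risk_of_law M \<rho> (distr P borel (\<lambda>(x, y). nrm (x - y)))"

(* The distribution (1/N) * (sum over i = 1, ..., N of the Dirac measure at f i);
   the points f i need not be distinct. *)
definition empirical :: "'b measure \<Rightarrow> nat \<Rightarrow> (nat \<Rightarrow> 'b) \<Rightarrow> 'b measure" where
  "empirical S N f = distr (uniform_count_measure {1..N}) S f"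

lemma emeasure_empirical:
  assumes "N \<ge> 1" and f: "\<And>i. i \<in> {1..N} \<Longrightarrow> f i \<in> space S" and A: "A \<in> sets S"
  shows "emeasure (empirical S N f) A =
           (\<Sum>i=1..N. ennreal (1 / real N) * indicator A (f i))"
proof -
  have meas: "f \<in> measurable (uniform_count_measure {1..N}) S"
    using f by (auto simp: measurable_def space_uniform_count_measure sets_uniform_count_measure)
  have "emeasure (empirical S N f) A =
          emeasure (uniform_count_measure {1..N}) (f -` A \<inter> {1..N})"
    unfolding empirical_def
    by (simp only: emeasure_distr[OF meas A] space_uniform_count_measure)
  also have "\<dots> = (\<Sum>i\<in>f -` A \<inter> {1..N}. ennreal (1 / real N))"
    unfolding uniform_count_measure_def
    by (subst emeasure_point_measure_finite) auto
  also have "\<dots> = (\<Sum>i=1..N. ennreal (1 / real N) * indicator A (f i))"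
    by (rule sum.mono_neutral_cong_left) (auto simp: indicator_def)
  finally show ?thesis .
qed

(* The trace of the Borel sigma-algebra: a convex set need not be a Borel set. *)
abbreviation support_space :: "'v::topological_space set \<Rightarrow> 'v measure" where
  "support_space \<Xi> \<equiv> restrict_space borel \<Xi>"

(* The Bochner integral would be 0 for non-integrable functions. The case
   infinity - infinity, which the library evaluates to infinity, does not occur below:
   rho dominates the mean, so y has finite mean, and a concave l has an affine majorant. *)
definition ext_expectation :: "'b measure \<Rightarrow> ('b \<Rightarrow> real) \<Rightarrow> ereal" where
  "ext_expectation P f =
     enn2ereal (\<integral>\<^sup>+x. ennreal (f x) \<partial>P) - enn2ereal (\<integral>\<^sup>+x. ennreal (- f x) \<partial>P)"

(* A pair (x, y) stands for the reference point x and the perturbed point y. *)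
definition feasible_couplings ::
    "'w measure \<Rightarrow> (('w \<Rightarrow> real) \<Rightarrow> ennreal) \<Rightarrow> ('v::real_normed_vector \<Rightarrow> real) \<Rightarrow>
       'v set \<Rightarrow> nat \<Rightarrow> (nat \<Rightarrow> 'v) \<Rightarrow> real \<Rightarrow> ('v \<times> 'v) measure set" where
  "feasible_couplings M \<rho> nrm \<Xi> N \<xi>hat \<epsilon> =
     {P. prob_space P \<and>
          sets P = sets (support_space \<Xi> \<Otimes>\<^sub>M support_space \<Xi>) \<and>
          distr P (support_space \<Xi>) fst = empirical (support_space \<Xi>) N \<xi>hat \<and>
          transport_risk M \<rho> nrm P \<le> ennreal \<epsilon>}"

definition feasible_points ::
    "'w measure \<Rightarrow> (('w \<Rightarrow> real) \<Rightarrow> ennreal) \<Rightarrow> ('v::real_normed_vector \<Rightarrow> real) \<Rightarrow>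
       'v set \<Rightarrow> nat \<Rightarrow> (nat \<Rightarrow> 'v) \<Rightarrow> real \<Rightarrow> (nat \<Rightarrow> 'v) set" where
  "feasible_points M \<rho> nrm \<Xi> N \<xi>hat \<epsilon> =
     {y. (\<forall>i\<in>{1..N}. y i \<in> \<Xi>) \<and>
         transport_risk M \<rho> nrm
           (empirical (support_space \<Xi> \<Otimes>\<^sub>M support_space \<Xi>) N (\<lambda>i. (\<xi>hat i, y i)))
           \<le> ennreal \<epsilon>}"

end

theory Submission
  imports Defs
begin

text \<open>
  Points to couplings is immediate: the empirical law of the pairs is itself a feasible coupling,
  and its expected loss is the average of the losses.

  For the converse, condition a feasible law \<open>P\<close> on its first component. The fibre over the
  \<open>i\<close>-th reference point is a probability law \<open>Q i\<close>, and \<open>P\<close> is the average of the \<open>Q i\<close>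
  (\<open>nn_integral_fibers\<close>; repeated reference points share a fibre). Moving all mass of the fibre to the mean
  \<open>y i\<close> of its second component gives the desired points: \<open>y i\<close> stays in the convex set
  by a separation argument (\<open>expectation_in_convex\<close>), the expected loss does not
  drop by Jensen's inequality for the concave loss, and by Jensen's inequality for the norm the
  distance from the \<open>i\<close>-th reference point to \<open>y i\<close> is at most the conditional mean of the
  transport cost.

  It remains to see that replacing a cost by its conditional means does not increase the risk
  (\<open>risk_of_law_conditional_means\<close>). The axioms give no continuity along sequences, so this is
  proved from averages of finitely many equidistributed variables. Let \<open>U\<close> be uniform
  (\<open>exists_uniform_variable\<close>). On the \<open>i\<close>-th of \<open>N\<close> equal subintervals of the range of \<open>U\<close>, realise
  the conditional law of the cost through its increasing rearrangement \<open>q\<close>, and cut the subinterval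
  into \<open>n\<close> equal cells. Replacing \<open>q\<close> by its value \<open>q (k / n)\<close> at the left end of the \<open>k\<close>-th
  cell makes the variable smaller. The step function so obtained keeps its law when the
  cells of each subinterval are shifted cyclically, and the average over all \<open>n\<close> shifts is constant on
  every subinterval, equal to the Riemann sum of \<open>q\<close>. By subadditivity, homogeneity and
  law invariance this average has at most the risk of the original cost. As \<open>n\<close> grows, the Riemann
  sum eventually exceeds any number below the integral of \<open>q\<close>, the conditional mean; the error is a small
  constant, which translation invariance absorbs.

  With \<open>N = 1\<close> the same fact says that the risk dominates the mean (\<open>mean_le_risk_of_law\<close>), so the
  transport cost of a feasible coupling is integrable; therefore so is the second component, and the
  means \<open>y i\<close> exist.
\<close>

section \<open>A uniform random variable on an atomless space\<close>

context atomless_prob_space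
begin

lemma exists_small_subset:
  assumes "A \<in> sets M" "0 < prob A" "0 < \<delta>"
  obtains B where "B \<in> sets M" "B \<subseteq> A" "0 < prob B" "prob B < \<delta>"
proof -
  have halve: "\<exists>B\<in>sets M. B \<subseteq> A \<and> 0 < prob B \<and> prob B \<le> prob A / 2"
    if A: "A \<in> sets M" "0 < prob A" for A
  proof -
    obtain B where B: "B \<in> sets M" "B \<subseteq> A" "0 < prob B" "prob B < prob A"
      using atomless[of A] A by (auto simp: emeasure_eq_measure ennreal_less_iff)
    have "prob (A - B) = prob A - prob B"
      using A B by (intro finite_measure_Diff) auto
    then show ?thesis
      using A B by (cases "prob B \<le> prob A / 2") (auto intro: bexI[of _ "A - B"] bexI[of _ B])
  qed
  have "\<exists>B\<in>sets M. B \<subseteq> A \<and> 0 < prob B \<and> prob B \<le> prob A / 2 ^ n" for n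
  proof (induction n)
    case 0 then show ?case using assms by auto
  next
    case (Suc n)
    then obtain B where B: "B \<in> sets M" "B \<subseteq> A" "0 < prob B" "prob B \<le> prob A / 2 ^ n" by auto
    from halve[OF B(1,3)] obtain C where "C \<in> sets M" "C \<subseteq> B" "0 < prob C" "prob C \<le> prob B / 2"
      by auto
    with B show ?case by (intro bexI[of _ C]) auto
  qed
  moreover obtain n where "prob A / 2 ^ n < \<delta>"
    using real_arch_pow_inv[of "\<delta> / prob A" "1/2"] assms by (auto simp: field_simps)
  ultimately show ?thesis using that by (meson order.strict_trans1)
qed

text \<open>
  Sierpinski's theorem, by a greedy exhaustion: each step adds a set at least half as large as the largest
  one that still fits. The increments of probability tend to zero, so nothing of positive
  probability can fit in the end, whereas an atomless space would supply a small set if the union fell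
  short of \<open>t\<close>.
\<close>
lemma exists_subset_of_prob:
  assumes A: "A \<in> sets M" and t: "0 \<le> t" "t \<le> prob A"
  obtains B where "B \<in> sets M" "B \<subseteq> A" "prob B = t"
proof -
  define P where "P = (\<lambda>(n::nat) B. B \<in> sets M \<and> B \<subseteq> A \<and> prob B \<le> t)"
  define Q where "Q = (\<lambda>(n::nat) B B'. B \<subseteq> B' \<and>
    (\<forall>C\<in>sets M. C \<subseteq> A - B \<longrightarrow> prob B + prob C \<le> t \<longrightarrow> prob C \<le> 2 * (prob B' - prob B)))"
  have "\<exists>f. \<forall>n. P n (f n) \<and> Q n (f n) (f (Suc n))"
  proof (rule dependent_nat_choice)
    show "\<exists>B. P 0 B" using t by (auto simp: P_def intro!: exI[of _ "{}"])
  next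
    fix B and n :: nat
    assume "P n B"
    then have B: "B \<in> sets M" "B \<subseteq> A" "prob B \<le> t" by (auto simp: P_def)
    define \<C> where "\<C> = {C \<in> sets M. C \<subseteq> A - B \<and> prob B + prob C \<le> t}"
    define s where "s = Sup (prob ` \<C>)"
    have empty: "{} \<in> \<C>" using B by (auto simp: \<C>_def)
    have bdd: "bdd_above (prob ` \<C>)" by (auto intro: bdd_aboveI[of _ 1])
    have upper: "prob C \<le> s" if "C \<in> \<C>" for C
      unfolding s_def using that bdd by (auto intro: cSup_upper)
    have "\<exists>C\<in>\<C>. s / 2 \<le> prob C"
    proof (cases "s = 0")
      case False
      then have "s / 2 < s" using upper[OF empty] by auto
      then obtain C where "C \<in> \<C>" "s / 2 < prob C"
        unfolding s_def using less_cSupD[of "prob ` \<C>" "s / 2"] empty by (auto simp: s_def)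
      then show ?thesis by force
    qed (use empty in auto)
    then obtain C where C: "C \<in> \<C>" "s / 2 \<le> prob C" by auto
    then have "prob (B \<union> C) = prob B + prob C"
      using B by (intro finite_measure_Union) (auto simp: \<C>_def)
    moreover have "prob C' \<le> 2 * prob C" if "C' \<in> \<C>" for C'
      using upper[OF that] C by linarith
    ultimately have "P (Suc n) (B \<union> C) \<and> Q n B (B \<union> C)"
      using B C by (auto simp: P_def Q_def \<C>_def)
    then show "\<exists>B'. P (Suc n) B' \<and> Q n B B'" by blast
  qed
  then obtain F where F: "\<And>n. P n (F n)" "\<And>n. Q n (F n) (F (Suc n))" by auto
  define B where "B = (\<Union>n. F n)"
  have F_sets: "F n \<in> sets M" "F n \<subseteq> A" "prob (F n) \<le> t" for n using F(1)[of n] by (auto simp: P_def)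
  have "incseq F" using F(2) by (auto simp: Q_def intro: incseq_SucI)
  then have lim: "(\<lambda>n. prob (F n)) \<longlonglongrightarrow> prob B"
    unfolding B_def using F_sets by (intro finite_Lim_measure_incseq) auto
  have B: "B \<in> sets M" "B \<subseteq> A" using F_sets by (auto simp: B_def)
  have le: "prob B \<le> t" by (rule LIMSEQ_le_const2[OF lim]) (use F_sets in auto)
  have "\<not> prob B < t"
  proof
    assume less: "prob B < t"
    have "prob (A - B) = prob A - prob B" using A B by (intro finite_measure_Diff) auto
    with less t have "0 < prob (A - B)" by linarith
    then obtain C where C: "C \<in> sets M" "C \<subseteq> A - B" "0 < prob C" "prob C < t - prob B"
      using exists_small_subset[of "A - B" "t - prob B"] A B less by auto
    have gap: "prob C \<le> 2 * (prob (F (Suc n)) - prob (F n))" for n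
    proof -
      have "prob (F n) \<le> prob B" using B by (intro finite_measure_mono) (auto simp: B_def)
      moreover have "C \<subseteq> A - F n" using C by (auto simp: B_def)
      ultimately show ?thesis using F(2)[of n] C by (auto simp: Q_def)
    qed
    have "(\<lambda>n. 2 * (prob (F (Suc n)) - prob (F n))) \<longlonglongrightarrow> 2 * (prob B - prob B)"
      by (intro tendsto_intros lim LIMSEQ_Suc)
    then have "prob C \<le> 2 * (prob B - prob B)"
      by (rule LIMSEQ_le_const) (use gap in auto)
    with C show False by simp
  qed
  with le B that show ?thesis by simp
qed

text \<open>
  \<open>K n\<close> holds the first \<open>n\<close> binary digits of the uniform variable to be constructed, read as
  an integer; each further digit splits every level set of \<open>K n\<close> into halves.
\<close>
lemma exists_dyadic_digits:
  "\<exists>K :: nat \<Rightarrow> 'w \<Rightarrow> nat. \<forall>n. K n \<in> M \<rightarrow>\<^sub>M count_space UNIV \<and> (\<forall>w. K n w < 2 ^ n) \<and>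
     (\<forall>k<2 ^ n. prob {w\<in>space M. K n w = k} = 1 / 2 ^ n) \<and> (\<forall>w. K (Suc n) w div 2 = K n w)"
proof -
  define P where "P = (\<lambda>n (K :: 'w \<Rightarrow> nat). K \<in> M \<rightarrow>\<^sub>M count_space UNIV \<and> (\<forall>w. K w < 2 ^ n) \<and>
     (\<forall>k<2 ^ n. prob {w\<in>space M. K w = k} = 1 / 2 ^ n))"
  define Q where "Q = (\<lambda>(n::nat) (K :: 'w \<Rightarrow> nat) K'. \<forall>w. K' w div 2 = K w)"
  have "\<exists>f. \<forall>n. P n (f n) \<and> Q n (f n) (f (Suc n))"
  proof (rule dependent_nat_choice)
    show "\<exists>K. P 0 K" by (auto simp: P_def prob_space intro!: exI[of _ "\<lambda>_. 0"])
  next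
    fix K :: "'w \<Rightarrow> nat" and n :: nat
    assume "P n K"
    then have K[measurable]: "K \<in> M \<rightarrow>\<^sub>M count_space UNIV" and lt: "\<And>w. K w < 2 ^ n"
      and pr: "\<And>k. k < 2 ^ n \<Longrightarrow> prob {w\<in>space M. K w = k} = 1 / 2 ^ n"
      by (auto simp: P_def)
    have "\<exists>B. B \<in> sets M \<and> B \<subseteq> {w\<in>space M. K w = k} \<and> prob B = prob {w\<in>space M. K w = k} / 2" for k
    proof -
      have "{w\<in>space M. K w = k} \<in> sets M" by measurable
      then obtain B where "B \<in> sets M" "B \<subseteq> {w\<in>space M. K w = k}" "prob B = prob {w\<in>space M. K w = k} / 2"
        by (rule exists_subset_of_prob[of _ "prob {w\<in>space M. K w = k} / 2"]) auto
      then show ?thesis by blast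
    qed
    then obtain h where h: "\<And>k. h k \<in> sets M" "\<And>k. h k \<subseteq> {w\<in>space M. K w = k}"
      "\<And>k. prob (h k) = prob {w\<in>space M. K w = k} / 2" by metis
    define K' where "K' w = 2 * K w + (if w \<in> h (K w) then 0 else 1)" for w
    have [measurable]: "Measurable.pred M (\<lambda>w. w \<in> h (K w))"
      by (rule measurable_compose_countable[OF _ K]) (use h in measurable)
    have [measurable]: "K' \<in> M \<rightarrow>\<^sub>M count_space UNIV" unfolding K'_def by measurable
    have lt': "K' w < 2 ^ Suc n" for w using lt[of w] by (auto simp: K'_def)
    have "prob {w\<in>space M. K' w = k} = 1 / 2 ^ Suc n" if "k < 2 ^ Suc n" for k
    proof -
      let ?A = "{w\<in>space M. K w = k div 2}"
      have half: "prob ?A = 1 / 2 ^ n" using that by (intro pr) auto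
      have "{w\<in>space M. K' w = k} = (if even k then h (k div 2) else ?A - h (k div 2))"
        using h(2)[of "k div 2"] by (auto simp: K'_def split: if_splits) 
      moreover have "prob (?A - h (k div 2)) = prob ?A - prob (h (k div 2))"
        using h by (intro finite_measure_Diff) auto
      ultimately show ?thesis using h(3)[of "k div 2"] half by (auto simp: field_simps)
    qed
    then have "P (Suc n) K' \<and> Q n K K'"
      using lt' by (auto simp: P_def Q_def K'_def)
    then show "\<exists>K'. P (Suc n) K' \<and> Q n K K'" by blast
  qed
  then obtain K where K: "\<forall>n. P n (K n) \<and> Q n (K n) (K (Suc n))" ..
  show ?thesis
  proof (intro exI allI)
    fix n
    show "K n \<in> M \<rightarrow>\<^sub>M count_space UNIV \<and> (\<forall>w. K n w < 2 ^ n) \<and>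
      (\<forall>k<2 ^ n. prob {w\<in>space M. K n w = k} = 1 / 2 ^ n) \<and> (\<forall>w. K (Suc n) w div 2 = K n w)"
      using K[THEN spec, of n] unfolding P_def Q_def by (elim conjE) (intro conjI)
  qed
qed

text \<open>
  The law is stated as a change-of-variables formula, the form in which it is used. The interval is
  half-open so that it is exactly a union of cells of the form \<open>[c / L, (c + 1) / L)\<close>.
\<close>
lemma exists_uniform_variable:
  "\<exists>U. U \<in> borel_measurable M \<and> (\<forall>w. 0 \<le> U w \<and> U w < 1) \<and>
     (\<forall>f\<in>borel_measurable borel. (\<integral>\<^sup>+w. f (U w) \<partial>M) = (\<integral>\<^sup>+u. f u * indicator {0..<1::real} u \<partial>lborel))"
proof -
  from exists_dyadic_digits obtain K :: "nat \<Rightarrow> 'w \<Rightarrow> nat" where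
    K: "\<forall>n. K n \<in> M \<rightarrow>\<^sub>M count_space UNIV \<and> (\<forall>w. K n w < 2 ^ n) \<and>
     (\<forall>k<2 ^ n. prob {w\<in>space M. K n w = k} = 1 / 2 ^ n) \<and> (\<forall>w. K (Suc n) w div 2 = K n w)" ..
  note K = K[THEN spec]
  have K_meas[measurable]: "K n \<in> M \<rightarrow>\<^sub>M count_space UNIV" for n
    by (rule K[THEN conjunct1])
  have K_less: "K n w < 2 ^ n" for n w
    by (rule K[THEN conjunct2, THEN conjunct1, THEN spec])
  have K_prob: "prob {w\<in>space M. K n w = k} = 1 / 2 ^ n" if "k < 2 ^ n" for n k
    by (rule K[THEN conjunct2, THEN conjunct2, THEN conjunct1, THEN spec, THEN mp, OF that])
  have K_Suc: "K (Suc n) w div 2 = K n w" for n w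
    by (rule K[THEN conjunct2, THEN conjunct2, THEN conjunct2, THEN spec])
  have lower: "real (K n w) / 2 ^ n \<le> real (K (n + j) w) / 2 ^ (n + j)" (is ?L)
    and upper: "(real (K (n + j) w) + 1) / 2 ^ (n + j) \<le> (real (K n w) + 1) / 2 ^ n" (is ?R) for n j w
  proof -
    have "?L \<and> ?R"
    proof (induction j)
      case (Suc j)
      let ?a = "K (n + j) w" and ?b = "K (n + Suc j) w"
      have "real (2 * ?a) \<le> real ?b" "real ?b \<le> real (2 * ?a + 1)"
        unfolding of_nat_le_iff using K_Suc[of "n + j" w] by auto
      then have "real ?a \<le> real ?b / 2" "(real ?b + 1) / 2 \<le> real ?a + 1" by simp_all
      then have "real ?a / 2 ^ (n + j) \<le> real ?b / 2 / 2 ^ (n + j)"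
        "(real ?b + 1) / 2 / 2 ^ (n + j) \<le> (real ?a + 1) / 2 ^ (n + j)"
        by (intro divide_right_mono; simp)+
      then have "real ?a / 2 ^ (n + j) \<le> real ?b / 2 ^ (n + Suc j)"
        "(real ?b + 1) / 2 ^ (n + Suc j) \<le> (real ?a + 1) / 2 ^ (n + j)"
        by (simp_all only: add_Suc_right power_Suc divide_divide_eq_left)
      with Suc show ?case by linarith
    qed simp
    then show ?L ?R by auto
  qed
  define V where "V w = lim (\<lambda>n. real (K n w) / 2 ^ n)" for w
  have V: "(\<lambda>n. real (K n w) / 2 ^ n) \<longlonglongrightarrow> V w" for w
  proof -
    have inc: "incseq (\<lambda>n. real (K n w) / 2 ^ n)" using lower[of _ w 1] by (intro incseq_SucI) simp
    have "\<forall>n. real (K n w) / 2 ^ n \<le> 1"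
    proof
      fix n
      have "real (K n w) \<le> real (2 ^ n)" unfolding of_nat_le_iff using K_less[of n w] by simp
      then show "real (K n w) / 2 ^ n \<le> 1" by simp
    qed
    then obtain L where "(\<lambda>n. real (K n w) / 2 ^ n) \<longlonglongrightarrow> L"
      by (rule incseq_convergent[OF inc])
    then have "convergent (\<lambda>n. real (K n w) / 2 ^ n)" by (rule convergentI)
    then show ?thesis by (simp add: V_def convergent_LIMSEQ_iff)
  qed
  have V_lower: "real (K n w) / 2 ^ n \<le> V w" for n w
    by (rule LIMSEQ_le_const[OF V]) (use lower[of n w] in \<open>auto simp: le_iff_add\<close>)
  have V_upper: "V w \<le> (real (K n w) + 1) / 2 ^ n" for n w
  proof (rule LIMSEQ_le_const2[OF V], intro exI allI impI)
    fix m assume "n \<le> m"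
    then obtain j where "m = n + j" using le_Suc_ex by blast
    moreover have "real (K m w) / 2 ^ m \<le> (real (K m w) + 1) / 2 ^ m" by (simp add: divide_right_mono)
    ultimately show "real (K m w) / 2 ^ m \<le> (real (K n w) + 1) / 2 ^ n" using upper[of n j w] by simp
  qed
  have [measurable]: "V \<in> borel_measurable M"
    by (rule borel_measurable_LIMSEQ_real[OF V]) measurable
  have below: "prob {w\<in>space M. K n w < k} = real k / 2 ^ n" if "k \<le> 2 ^ n" for n k
  proof -
    have "prob {w\<in>space M. K n w < k} = prob (\<Union>j<k. {w\<in>space M. K n w = j})"
      by (rule arg_cong[of _ _ prob]) auto
    also have "\<dots> = (\<Sum>j<k. prob {w\<in>space M. K n w = j})"
      by (intro finite_measure_finite_Union) (auto simp: disjoint_family_on_def)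
    also have "\<dots> = (\<Sum>j<k. 1 / 2 ^ n)" using that by (intro sum.cong) (auto simp: K_prob)
    finally show ?thesis by simp
  qed
  have V_cdf: "prob {w\<in>space M. V w \<le> x} = x" if x: "0 \<le> x" "x < 1" for x
  proof -
    have bound: "\<bar>prob {w\<in>space M. V w \<le> x} - x\<bar> \<le> (1/2) ^ n" for n
    proof -
      define k where "k = nat \<lfloor>x * 2 ^ n\<rfloor>"
      have k: "real k \<le> x * 2 ^ n" "x * 2 ^ n < real k + 1" using x by (auto simp: k_def)
      have kx: "real k / 2 ^ n \<le> x" "x < (real k + 1) / 2 ^ n" using k by (auto simp: field_simps)
      have "x * 2 ^ n < 1 * 2 ^ n" using x by (intro mult_strict_right_mono) auto
      from order.strict_trans1[OF k(1) this] have "real k < real (2 ^ n)"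
        by (simp only: mult_1 of_nat_power of_nat_numeral)
      then have kn: "k < 2 ^ n" unfolding of_nat_less_iff .
      have "real k / 2 ^ n = prob {w\<in>space M. K n w < k}" using kn by (simp add: below)
      also have "\<dots> \<le> prob {w\<in>space M. V w \<le> x}"
      proof (intro finite_measure_mono Collect_mono conj_mono impI)
        fix w assume "K n w < k"
        then have "(real (K n w) + 1) / 2 ^ n \<le> real k / 2 ^ n" by (intro divide_right_mono) auto
        with V_upper[of w n] kx(1) show "V w \<le> x" by linarith
      qed auto
      finally have lo: "real k / 2 ^ n \<le> prob {w\<in>space M. V w \<le> x}" .
      have "prob {w\<in>space M. V w \<le> x} \<le> prob {w\<in>space M. K n w < Suc k}"
      proof (intro finite_measure_mono Collect_mono conj_mono impI)
        fix w assume "V w \<le> x"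
        with V_lower[of n w] kx(2) have "real (K n w) / 2 ^ n < (real k + 1) / 2 ^ n" by linarith
        then have "real (K n w) < real k + 1" by (simp only: divide_less_cancel) simp
        then show "K n w < Suc k" by simp
      qed auto
      also have "\<dots> = (real k + 1) / 2 ^ n" using kn by (simp add: below)
      finally have up: "prob {w\<in>space M. V w \<le> x} \<le> (real k + 1) / 2 ^ n" .
      from kx lo up show ?thesis by (auto simp: abs_le_iff power_one_over add_divide_distrib)
    qed
    have "(\<lambda>n. (1/2::real) ^ n) \<longlonglongrightarrow> 0" by (intro LIMSEQ_power_zero) auto
    then have "\<bar>prob {w\<in>space M. V w \<le> x} - x\<bar> \<le> 0"
      by (rule LIMSEQ_le_const) (use bound in auto)
    then show ?thesis by simp
  qed
  have V_range: "0 \<le> V w" "V w \<le> 1" for w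
    using V_lower[of 0 w] V_upper[of w 0] K_less[of 0 w] by auto
  let ?unif = "uniform_measure lborel {0<..<1::real}"
  have distr_V: "distr M borel V = ?unif"
  proof (rule cdf_unique)
    show "real_distribution (distr M borel V)" by (simp add: real_distribution_distr)
    have "prob_space ?unif" by (rule prob_space_uniform_measure) auto
    then show "real_distribution ?unif"
      by (simp add: real_distribution_def real_distribution_axioms_def)
    show "cdf (distr M borel V) = cdf ?unif"
    proof
      fix x :: real
      have "cdf (distr M borel V) x = prob {w\<in>space M. V w \<le> x}"
        by (auto simp: cdf_def measure_distr intro!: arg_cong[of _ _ prob])
      also have "\<dots> = (if x < 0 then 0 else if x < 1 then x else 1)"
      proof -
        consider "x < 0" | "0 \<le> x" "x < 1" | "1 \<le> x" by linarith
        then show ?thesis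
        proof cases
          case 1
          then have "{w\<in>space M. V w \<le> x} = {}" using order.trans[OF V_range(1)] by force
          then show ?thesis using 1 by (simp only: measure_empty if_True)
        next
          case 3
          then have "{w\<in>space M. V w \<le> x} = space M" using order.trans[OF V_range(2)] by auto
          then show ?thesis using 3 by (simp add: prob_space)
        qed (simp add: V_cdf)
      qed
      also have "\<dots> = measure lborel ({0<..<1} \<inter> {..x})"
      proof -
        have "{0<..<1} \<inter> {..x} = (if x < 1 then {0<..x} else {0<..<1})" by auto
        then show ?thesis by auto
      qed
      also have "\<dots> = cdf ?unif x" by (simp add: cdf_def)
      finally show "cdf (distr M borel V) x = cdf ?unif x" .
    qed
  qed
  \<comment> \<open>The limit \<open>V\<close> may hit an endpoint on a null set; any value inside the interval will do there.\<close>
  define U where "U w = (if V w \<in> {0<..<1} then V w else 1 / 2)" for w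
  have [measurable]: "U \<in> borel_measurable M" unfolding U_def by measurable
  have integral: "(\<integral>\<^sup>+w. f (U w) \<partial>M) = (\<integral>\<^sup>+u. f u * indicator {0<..<1} u \<partial>lborel)"
    if [measurable]: "f \<in> borel_measurable borel" for f :: "real \<Rightarrow> ennreal"
  proof -
    define g where "g u = f (if u \<in> {0<..<1} then u else 1 / 2)" for u
    have [measurable]: "g \<in> borel_measurable borel" unfolding g_def by measurable
    have "(\<integral>\<^sup>+w. f (U w) \<partial>M) = (\<integral>\<^sup>+w. g (V w) \<partial>M)" by (simp add: U_def g_def)
    also have "\<dots> = (\<integral>\<^sup>+u. g u \<partial>distr M borel V)" by (simp add: nn_integral_distr)
    also have "\<dots> = (\<integral>\<^sup>+u. g u * indicator {0<..<1} u \<partial>lborel)"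
      unfolding distr_V by (subst nn_integral_uniform_measure) (auto simp: divide_ennreal_def)
    also have "\<dots> = (\<integral>\<^sup>+u. f u * indicator {0<..<1} u \<partial>lborel)"
      by (intro nn_integral_cong) (auto simp: g_def indicator_def)
    finally show ?thesis .
  qed
  show ?thesis
  proof (intro exI conjI ballI allI)
    show "U \<in> borel_measurable M" by measurable
    show "0 \<le> U w" "U w < 1" for w by (auto simp: U_def)
    fix f :: "real \<Rightarrow> ennreal"
    assume f: "f \<in> borel_measurable borel"
    show "(\<integral>\<^sup>+w. f (U w) \<partial>M) = (\<integral>\<^sup>+u. f u * indicator {0..<1} u \<partial>lborel)"
      unfolding integral[OF f]
      using AE_lborel_singleton[of 0] by (intro nn_integral_cong_AE) (auto simp: indicator_def)
  qed
qed

end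

section \<open>Convexity and expectations\<close>

text \<open>
  By induction on dimension. If the mean were outside \<open>S\<close>, a hyperplane through it would have \<open>S\<close> on one
  side; having mean zero, the signed distance to the hyperplane vanishes almost surely, so \<open>f\<close> lives on
  the lower-dimensional slice of \<open>S\<close>. Only almost sure membership is tracked, which
  makes sense for sets that are not measurable.
\<close>
lemma expectation_in_convex:
  fixes f :: "'b \<Rightarrow> 'v::euclidean_space"
  assumes "prob_space P" and f: "integrable P f"
    and "convex S" and "AE x in P. f x \<in> S"
  shows "(\<integral>x. f x \<partial>P) \<in> S"
proof -
  interpret prob_space P by fact
  define m where "m = (\<integral>x. f x \<partial>P)"
  from assms(3,4) have "m \<in> S"
  proof (induction "nat (aff_dim (insert m S) + 1)" arbitrary: S rule: less_induct)
    case less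
    show ?case
    proof (rule ccontr)
      assume "m \<notin> S"
      moreover have "S \<noteq> {}" using less.prems(2) by auto
      ultimately obtain a b where a: "m + a \<in> affine hull (insert m S)" "a \<noteq> 0"
        and b: "a \<bullet> m \<le> b" "\<And>x. x \<in> S \<Longrightarrow> b \<le> a \<bullet> x"
        using separating_hyperplane_set_point_inaff[OF less.prems(1)] by metis
      have int: "integrable P (\<lambda>x. a \<bullet> f x - a \<bullet> m)" using f by simp
      have "(\<integral>x. a \<bullet> f x - a \<bullet> m \<partial>P) = 0" using f by (simp add: m_def prob_space)
      moreover have "AE x in P. 0 \<le> a \<bullet> f x - a \<bullet> m"
        using less.prems(2) by eventually_elim (use b in force)
      ultimately have "AE x in P. a \<bullet> f x - a \<bullet> m = 0"
        using integral_nonneg_eq_0_iff_AE[OF int] by simp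
      define S' where "S' = S \<inter> {x. a \<bullet> x = a \<bullet> m}"
      have "AE x in P. f x \<in> S'"
        using \<open>AE x in P. a \<bullet> f x - a \<bullet> m = 0\<close> less.prems(2) by eventually_elim (auto simp: S'_def)
      moreover have "convex S'"
        using less.prems(1) unfolding S'_def by (intro convex_Int convex_hyperplane)
      moreover have "aff_dim (insert m S') < aff_dim (insert m S)"
      proof (rule aff_dim_psubset)
        have "affine hull insert m S' \<subseteq> {x. a \<bullet> x = a \<bullet> m}"
          by (intro hull_minimal affine_hyperplane) (auto simp: S'_def)
        moreover have "m + a \<notin> {x. a \<bullet> x = a \<bullet> m}" using a(2) by (simp add: inner_add_right)
        moreover have "affine hull insert m S' \<subseteq> affine hull insert m S"
          by (intro hull_mono) (auto simp: S'_def)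
        ultimately show "affine hull insert m S' \<subset> affine hull insert m S" using a(1) by blast
      qed
      then have "nat (aff_dim (insert m S') + 1) < nat (aff_dim (insert m S) + 1)"
        using aff_dim_geq[of "insert m S'"] by simp
      ultimately have "m \<in> S'" by (intro less.hyps)
      with \<open>m \<notin> S\<close> show False by (simp add: S'_def)
    qed
  qed
  then show ?thesis by (simp add: m_def)
qed

text \<open>
  The pair \<open>(f, l \<circ> f)\<close> takes values in the hypograph of \<open>l\<close>, a convex set, hence so does its mean.
\<close>
lemma jensen_concave:
  fixes f :: "'b \<Rightarrow> 'v::euclidean_space"
  assumes "prob_space P" and f: "integrable P f" and "concave_on S l"
    and "AE x in P. f x \<in> S" and lf: "integrable P (\<lambda>x. l (f x))"
  shows "(\<integral>x. l (f x) \<partial>P) \<le> l (\<integral>x. f x \<partial>P)"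
proof -
  let ?H = "{p. fst p \<in> S \<and> snd p \<le> l (fst p)}"
  have "convex ?H"
  proof (rule convexI)
    fix p q :: "'v \<times> real" and u v :: real
    assume *: "p \<in> ?H" "q \<in> ?H" "0 \<le> u" "0 \<le> v" "u + v = 1"
    then have "u * snd p + v * snd q \<le> u * l (fst p) + v * l (fst q)"
      by (intro add_mono mult_left_mono) auto
    also have "\<dots> \<le> l (u *\<^sub>R fst p + v *\<^sub>R fst q)"
      using * \<open>concave_on S l\<close> unfolding concave_on_iff by auto
    finally show "u *\<^sub>R p + v *\<^sub>R q \<in> ?H"
      using * \<open>concave_on S l\<close> unfolding concave_on_iff by (auto intro: convexD)
  qed
  moreover have int: "integrable P (\<lambda>x. (f x, l (f x)))"
    using Bochner_Integration.integrable_add[OF integrable_bounded_linear[OF bounded_linear_Pair[OF bounded_linear_ident bounded_linear_zero] f]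
        integrable_bounded_linear[OF bounded_linear_Pair[OF bounded_linear_zero bounded_linear_ident] lf]]
    by simp
  moreover have "AE x in P. (f x, l (f x)) \<in> ?H"
    using assms(4) by eventually_elim simp
  ultimately have "(\<integral>x. (f x, l (f x)) \<partial>P) \<in> ?H"
    by (intro expectation_in_convex \<open>prob_space P\<close>)
  then show ?thesis
    using integral_bounded_linear[OF bounded_linear_fst int] integral_bounded_linear[OF bounded_linear_snd int]
    by simp
qed

lemma continuous_on_concave:
  fixes l :: "'v::euclidean_space \<Rightarrow> real"
  assumes "concave_on UNIV l"
  shows "continuous_on UNIV l"
  using continuous_on_minus[OF convex_on_continuous[OF open_UNIV assms[unfolded concave_on_def]]] by simp

text \<open>
  Used to see that the positive part of the loss is integrable. Outside the unit ball, concavity along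
  the segment from \<open>0\<close> to \<open>x\<close> bounds \<open>l x\<close> by the values of \<open>l\<close> on the ball, where
  \<open>l\<close> is bounded by compactness.
\<close>
lemma concave_linear_growth:
  fixes l :: "'v::euclidean_space \<Rightarrow> real"
  assumes l: "concave_on UNIV l"
  obtains C where "C \<ge> 0" "\<And>x. l x \<le> C * (1 + norm x)"
proof -
  have "bounded (l ` cball 0 1)"
    using continuous_on_subset[OF continuous_on_concave[OF l]]
    by (intro compact_imp_bounded compact_continuous_image) auto
  then obtain B where B: "\<And>x. norm x \<le> 1 \<Longrightarrow> \<bar>l x\<bar> \<le> B" unfolding bounded_iff by force
  have l0: "\<bar>l 0\<bar> \<le> B" by (rule B) simp
  show ?thesis
  proof (rule that[of "2 * B"])
    show "0 \<le> 2 * B" using l0 by linarith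
    fix x
    show "l x \<le> 2 * B * (1 + norm x)"
    proof (cases "norm x \<le> 1")
      case True
      then have "l x \<le> B" using B[of x] by linarith
      moreover have "0 \<le> B * norm x" using l0 by (intro mult_nonneg_nonneg) auto
      ultimately have "l x \<le> 2 * B + 2 * (B * norm x)" using l0 by linarith
      then show ?thesis by (simp add: algebra_simps)
    next
      case False
      define t where "t = 1 / norm x"
      have "1 < norm x" using False by simp
      then have t: "0 < t" "t < 1" "t * norm x = 1" unfolding t_def by (auto simp: divide_less_eq_1)
      have "t * l x + (1 - t) * l 0 \<le> l (t *\<^sub>R x + (1 - t) *\<^sub>R 0)"
        using l t unfolding concave_on_iff by (metis UNIV_I add_diff_cancel_left' diff_add_cancel diff_ge_0_iff_ge less_imp_le)
      also have "\<dots> \<le> B" using B[of "t *\<^sub>R x"] t by simp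
      finally have "t * l x \<le> B - (1 - t) * l 0" by simp
      moreover have "(1 - t) * (- l 0) \<le> (1 - t) * B" using t l0 by (intro mult_left_mono) auto
      moreover have "(1 - t) * B \<le> 1 * B" using t l0 by (intro mult_right_mono) auto
      ultimately have "t * l x \<le> 2 * B" by simp
      then have "norm x * (t * l x) \<le> norm x * (2 * B)" by (intro mult_left_mono) auto
      moreover have "norm x * (t * l x) = (t * norm x) * l x" by (simp only: mult_ac)
      ultimately have "l x \<le> norm x * (2 * B)" by (simp only: t(3) mult_1)
      then show ?thesis using l0 by (simp add: algebra_simps)
    qed
  qed
qed

lemma is_norm_convex: "is_norm nrm \<Longrightarrow> convex_on UNIV nrm"
  unfolding convex_on_def is_norm_def by (smt (verit) convex_UNIV)

lemma continuous_on_is_norm: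
  fixes nrm :: "'v::euclidean_space \<Rightarrow> real"
  assumes "is_norm nrm" shows "continuous_on UNIV nrm"
  by (intro convex_on_continuous is_norm_convex assms) simp

text \<open>
  Equivalence with the Euclidean norm: \<open>nrm\<close> attains a positive minimum on the unit sphere. It turns
  integrability of the transport cost into integrability of the displacement.
\<close>
lemma is_norm_dominates:
  fixes nrm :: "'v::euclidean_space \<Rightarrow> real"
  assumes nrm: "is_norm nrm"
  obtains c where "c \<ge> 0" "\<And>x. norm x \<le> c * nrm x"
proof -
  have "sphere (0::'v) 1 \<noteq> {}" by simp
  moreover have "continuous_on (sphere 0 1) nrm"
    using continuous_on_is_norm[OF nrm] continuous_on_subset by blast
  ultimately obtain z where z: "norm z = 1" "\<And>x. norm x = 1 \<Longrightarrow> nrm z \<le> nrm x"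
    using continuous_attains_inf[of "sphere 0 1" nrm] by auto
  have pos: "0 < nrm z" using nrm z(1) unfolding is_norm_def by (metis less_eq_real_def norm_zero zero_neq_one)
  show ?thesis
  proof (rule that[of "1 / nrm z"])
    show "0 \<le> 1 / nrm z" using pos by simp
    fix x
    show "norm x \<le> 1 / nrm z * nrm x"
    proof (cases "x = 0")
      case False
      have "nrm z \<le> nrm ((1 / norm x) *\<^sub>R x)" using False by (intro z(2)) simp
      also have "\<dots> = 1 / norm x * nrm x" using nrm unfolding is_norm_def by simp
      finally show ?thesis using False pos by (simp add: field_simps)
    qed (use nrm pos in \<open>auto simp: is_norm_def\<close>)
  qed
qed

section \<open>Increasing rearrangements and Riemann sums\<close>

lemma borel_measurable_frac[measurable]: "(frac :: real \<Rightarrow> real) \<in> borel_measurable borel"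
  unfolding frac_def by measurable

text \<open>
  Under the uniform law the index of the cell and the position within it are independent and uniform,
  which makes every variable below a function of the two.
\<close>
lemma nn_integral_cells:
  fixes h :: "nat \<Rightarrow> real \<Rightarrow> ennreal"
  assumes L: "1 \<le> L" and h[measurable]: "\<And>c. h c \<in> borel_measurable borel"
  shows "(\<integral>\<^sup>+u. h (nat \<lfloor>real L * u\<rfloor>) (frac (real L * u)) * indicator {0..<1} u \<partial>lborel) =
    ennreal (1 / real L) * (\<Sum>c<L. \<integral>\<^sup>+t. h c t * indicator {0..<1} t \<partial>lborel)"
proof -
  define g where "g c t = h c t * indicator {0..<1} t" for c t
  have [measurable]: "g c \<in> borel_measurable borel" for c unfolding g_def by measurable
  have "h (nat \<lfloor>real L * u\<rfloor>) (frac (real L * u)) * indicator {0..<1} u =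
    (\<Sum>c<L. g c (- real c + real L * u))" for u
  proof (cases "u \<in> {0..<1}")
    case True
    define a where "a = nat \<lfloor>real L * u\<rfloor>"
    have nonneg: "0 \<le> real L * u" using True by simp
    then have a: "real a = of_int \<lfloor>real L * u\<rfloor>" by (simp add: a_def)
    have "real a \<le> real L * u" unfolding a by (rule of_int_floor_le)
    also have "\<dots> < real L * 1" using True L by (intro mult_strict_left_mono) auto
    finally have "a < L" by simp
    have off: "g c (- real c + real L * u) = 0" if "c \<noteq> a" for c
    proof -
      have "- real c + real L * u \<notin> {0..<1}"
      proof
        assume "- real c + real L * u \<in> {0..<1}"
        then have "\<lfloor>real L * u\<rfloor> = int c" by (intro floor_unique) auto
        with that show False by (simp add: a_def)
      qed
      then show ?thesis by (simp add: g_def)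
    qed
    have "(\<Sum>c<L. g c (- real c + real L * u)) = (\<Sum>c\<in>{a}. g c (- real c + real L * u))"
      using \<open>a < L\<close> off by (intro sum.mono_neutral_right) auto
    also have "- real a + real L * u = frac (real L * u)" by (simp add: frac_def a)
    then have "(\<Sum>c\<in>{a}. g c (- real c + real L * u)) = h a (frac (real L * u))"
      by (simp add: g_def frac_lt_1)
    finally show ?thesis using True by (simp add: a_def)
  next
    case False
    have "g c (- real c + real L * u) = 0" if "c < L" for c
    proof -
      have "- real c + real L * u \<notin> {0..<1}"
      proof
        assume *: "- real c + real L * u \<in> {0..<1}"
        have "real c + 1 \<le> real L" using that by linarith
        from * have bounds: "real c \<le> real L * u" "real L * u < real c + 1" by auto
        with that have "real L * u < real L * 1" by linarith
        then have "u < 1" by (rule mult_left_less_imp_less) simp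
        moreover have "0 \<le> u" using bounds L by (auto simp: zero_le_mult_iff dest: order.trans[OF of_nat_0_le_iff])
        ultimately show False using False by simp
      qed
      then show ?thesis by (simp add: g_def)
    qed
    with False show ?thesis by simp
  qed
  then have "(\<integral>\<^sup>+u. h (nat \<lfloor>real L * u\<rfloor>) (frac (real L * u)) * indicator {0..<1} u \<partial>lborel) =
    (\<integral>\<^sup>+u. (\<Sum>c<L. g c (- real c + real L * u)) \<partial>lborel)" by simp
  also have "\<dots> = (\<Sum>c<L. \<integral>\<^sup>+u. g c (- real c + real L * u) \<partial>lborel)"
    by (intro nn_integral_sum) measurable
  also have "\<dots> = (\<Sum>c<L. ennreal (1 / real L) * (\<integral>\<^sup>+t. g c t \<partial>lborel))"
  proof (intro sum.cong refl)
    fix c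
    have "ennreal (1 / real L) * (\<integral>\<^sup>+t. g c t \<partial>lborel) =
      (ennreal (1 / real L) * ennreal \<bar>real L\<bar>) * (\<integral>\<^sup>+u. g c (- real c + real L * u) \<partial>lborel)"
      using L by (subst nn_integral_real_affine[of "g c" "real L" "- real c"]) (auto simp: mult.assoc)
    also have "ennreal (1 / real L) * ennreal \<bar>real L\<bar> = 1"
      using L by (simp flip: ennreal_mult)
    finally show "(\<integral>\<^sup>+u. g c (- real c + real L * u) \<partial>lborel) = ennreal (1 / real L) * (\<integral>\<^sup>+t. g c t \<partial>lborel)"
      by simp
  qed
  finally show ?thesis by (simp add: g_def sum_distrib_left)
qed

lemma nn_integral_cells_const:
  fixes x :: "nat \<Rightarrow> ennreal"
  assumes "1 \<le> L"
  shows "(\<integral>\<^sup>+u. x (nat \<lfloor>real L * u\<rfloor>) * indicator {0..<1} u \<partial>lborel) = ennreal (1 / real L) * (\<Sum>c<L. x c)"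
  using nn_integral_cells[of L "\<lambda>c _. x c"] assms by (simp add: nn_integral_cmult)

text \<open>
  A monotone realisation of \<open>\<nu>\<close> on the unit interval under Lebesgue measure. The interval includes \<open>0\<close>,
  so that Riemann sums of left end values may start there.
\<close>
definition increasing_rearrangement :: "real measure \<Rightarrow> (real \<Rightarrow> real) \<Rightarrow> bool" where
  "increasing_rearrangement \<nu> q \<longleftrightarrow>
     q \<in> borel_measurable borel \<and> (\<forall>t. 0 \<le> q t) \<and> mono_on {0..<1} q \<and>
     (\<forall>f\<in>borel_measurable borel.
        (\<integral>\<^sup>+x. f x \<partial>\<nu>) = (\<integral>\<^sup>+t. (f (q t) :: ennreal) * indicator {0..<1} t \<partial>lborel))"

text \<open>
  The quantile function works on the open unit interval; the value \<open>0\<close> elsewhere keeps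
  it monotone at the left end, because the law lives on the nonnegative reals.
\<close>
lemma exists_increasing_rearrangement:
  assumes "real_distribution \<nu>" and nonneg: "AE x in \<nu>. 0 \<le> x"
  shows "\<exists>q. increasing_rearrangement \<nu> q"
proof -
  interpret cdf_distribution \<nu> unfolding cdf_distribution_def by fact
  define q where "q t = (if 0 < t \<and> t < 1 then max 0 (I t) else 0)" for t
  have rs: "{t::real. 0 < t \<and> t < 1} = {0<..<1}" by auto
  have [measurable]: "q \<in> borel_measurable borel"
    unfolding q_def by (subst measurable_If_restrict_space_iff) (auto simp: rs intro!: borel_measurable_max)
  show ?thesis
    unfolding increasing_rearrangement_def
  proof (intro exI conjI ballI allI)
    show "q \<in> borel_measurable borel" by measurable
    show "0 \<le> q t" for t by (simp add: q_def)
    show "mono_on {0..<1} q"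
    proof (rule mono_onI)
      fix r s :: real
      assume *: "r \<in> {0..<1}" "s \<in> {0..<1}" "r \<le> s"
      show "q r \<le> q s"
      proof (cases "0 < r")
        case True
        with * have "I r \<le> I s" by (intro mono_onD[OF mono_I]) auto
        then have "max 0 (I r) \<le> max 0 (I s)" by (rule max.mono[OF order_refl])
        with True * show ?thesis by (simp add: q_def)
      qed (simp add: q_def)
    qed
    fix f :: "real \<Rightarrow> ennreal"
    assume [measurable]: "f \<in> borel_measurable borel"
    have "(\<integral>\<^sup>+x. f x \<partial>\<nu>) = (\<integral>\<^sup>+x. f (max 0 x) \<partial>\<nu>)"
      using nonneg by (intro nn_integral_cong_AE) (auto simp: max_def)
    also have "\<dots> = (\<integral>\<^sup>+x. f (max 0 x) \<partial>distr (restrict_space lborel {0<..<1}) borel I)"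
      by (simp only: distr_I_eq_M)
    also have "\<dots> = (\<integral>\<^sup>+t. f (max 0 (I t)) \<partial>restrict_space lborel {0<..<1})"
      by (subst nn_integral_distr) (auto simp: measurable_lborel1 cong: measurable_cong_sets)
    also have "\<dots> = (\<integral>\<^sup>+t. f (max 0 (I t)) * indicator {0<..<1} t \<partial>lborel)"
      by (subst nn_integral_restrict_space) auto
    also have "\<dots> = (\<integral>\<^sup>+t. f (q t) * indicator {0..<1} t \<partial>lborel)"
      using AE_lborel_singleton[of 0] by (intro nn_integral_cong_AE) (auto simp: indicator_def q_def)
    finally show "(\<integral>\<^sup>+x. f x \<partial>\<nu>) = (\<integral>\<^sup>+t. f (q t) * indicator {0..<1} t \<partial>lborel)" .
  qed
qed

text \<open>
  On each cell but the last, \<open>q\<close> is at most its value at the right end, which is the left end of the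
  next cell. The last cell is given up because \<open>q\<close> may be unbounded there.
\<close>
lemma lower_sum_ge_truncated_integral:
  fixes q :: "real \<Rightarrow> real"
  assumes q[measurable]: "q \<in> borel_measurable borel" and nonneg: "\<And>t. 0 \<le> q t"
    and mono: "mono_on {0..<1} q" and n: "1 \<le> n"
  shows "(\<integral>\<^sup>+t. ennreal (q t) * indicator {0..<1 - 1 / real n} t \<partial>lborel)
    \<le> ennreal ((\<Sum>k<n. q (real k / real n)) / real n)"
proof -
  define x where "x c = (if Suc c < n then ennreal (q (real (Suc c) / real n)) else 0)" for c
  have "ennreal (q t) * indicator {0..<1 - 1 / real n} t \<le> x (nat \<lfloor>real n * t\<rfloor>) * indicator {0..<1} t" for t
  proof (cases "t \<in> {0..<1 - 1 / real n}")
    case True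
    define c where "c = nat \<lfloor>real n * t\<rfloor>"
    have "0 \<le> real n * t" using True by simp
    then have c: "real c \<le> real n * t" "real n * t < real c + 1" unfolding c_def by linarith+
    have "real n * t < real n * (1 - 1 / real n)" using True n by (intro mult_strict_left_mono) auto
    with c n have "real (Suc c) < real n" by (simp add: algebra_simps)
    then have less: "Suc c < n" unfolding of_nat_less_iff .
    have "t \<le> real (Suc c) / real n" using c n by (simp add: field_simps)
    moreover have "real (Suc c) / real n < 1" using less n by simp
    moreover have "t < 1" using True by (auto intro: less_le_trans)
    ultimately have "q t \<le> q (real (Suc c) / real n)" using True n by (intro mono_onD[OF mono]) auto
    with less True \<open>t < 1\<close> show ?thesis unfolding c_def[symmetric] by (auto simp: x_def intro: ennreal_leI)
  qed simp
  then have "(\<integral>\<^sup>+t. ennreal (q t) * indicator {0..<1 - 1 / real n} t \<partial>lborel)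
    \<le> (\<integral>\<^sup>+t. x (nat \<lfloor>real n * t\<rfloor>) * indicator {0..<1} t \<partial>lborel)" by (intro nn_integral_mono) simp
  also have "\<dots> = ennreal (1 / real n) * (\<Sum>c<n. x c)" by (rule nn_integral_cells_const[OF n])
  also have "(\<Sum>c<n. x c) = (\<Sum>c<n - 1. ennreal (q (real (Suc c) / real n)))"
    unfolding x_def by (intro sum.mono_neutral_cong_right) auto
  also have "\<dots> \<le> ennreal (q 0) + \<dots>" by simp
  also have "\<dots> = (\<Sum>k<n. ennreal (q (real k / real n)))"
    using n sum.lessThan_Suc_shift[of "\<lambda>k. ennreal (q (real k / real n))" "n - 1"] by simp
  also have "\<dots> = ennreal (\<Sum>k<n. q (real k / real n))" using nonneg by (intro sum_ennreal) auto
  finally show ?thesis using nonneg n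
    by (simp add: mult_left_mono sum_nonneg flip: ennreal_mult)
qed

text \<open>
  The integral may be infinite, so the statement is about a number \<open>d\<close> below it; monotone convergence
  recovers the cell that the previous lemma gives up.
\<close>
lemma eventually_lower_sum_ge:
  fixes q :: "real \<Rightarrow> real"
  assumes q[measurable]: "q \<in> borel_measurable borel" and nonneg: "\<And>t. 0 \<le> q t"
    and mono: "mono_on {0..<1} q"
    and d: "ennreal d \<le> (\<integral>\<^sup>+t. ennreal (q t) * indicator {0..<1} t \<partial>lborel)" and "0 < \<delta>"
  shows "eventually (\<lambda>n. d \<le> (\<Sum>k<Suc n. q (real k / real (Suc n))) / real (Suc n) + \<delta>) sequentially"
  \<comment> \<open>The embedding of the reals in \<open>ennreal\<close> truncates negative numbers, so \<open>d - \<delta>\<close> must be positive.\<close>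
proof (cases "d \<le> \<delta>")
  case True
  moreover have "0 \<le> (\<Sum>k<Suc n. q (real k / real (Suc n))) / real (Suc n)" for n
    using nonneg by (intro divide_nonneg_nonneg sum_nonneg) auto
  ultimately show ?thesis by (intro always_eventually allI) (meson add_increasing)
next
  case False
  let ?f = "\<lambda>n t. ennreal (q t) * indicator {0..<1 - 1 / real (Suc n)} t"
  have "(\<lambda>n. \<integral>\<^sup>+t. ?f n t \<partial>lborel) \<longlonglongrightarrow> (\<integral>\<^sup>+t. ennreal (q t) * indicator {0..<1} t \<partial>lborel)"
  proof (rule nn_integral_LIMSEQ)
    show "incseq ?f"
    proof (rule incseq_SucI, rule le_funI)
      fix n t
      have "1 - 1 / real (Suc n) \<le> 1 - 1 / real (Suc (Suc n))" by (simp add: field_simps)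
      then show "?f n t \<le> ?f (Suc n) t" by (auto simp: indicator_def intro: less_le_trans)
    qed
    show "?f n \<in> borel_measurable lborel" for n by measurable
    show "(\<lambda>n. ?f n t) \<longlonglongrightarrow> ennreal (q t) * indicator {0..<1} t" for t
    proof (rule tendsto_eventually)
      show "eventually (\<lambda>n. ?f n t = ennreal (q t) * indicator {0..<1} t) sequentially"
      proof (cases "0 \<le> t \<and> t < 1")
        case True
        have "(\<lambda>n. 1 - 1 / real (Suc n)) \<longlonglongrightarrow> 1 - 0"
          by (intro tendsto_intros LIMSEQ_Suc lim_1_over_n)
        then have "eventually (\<lambda>n. t < 1 - 1 / real (Suc n)) sequentially"
          using True by (intro order_tendstoD) auto
        then show ?thesis by eventually_elim (use True in simp)
      next
        case False
        have "1 - 1 / real (Suc n) \<le> 1" for n by simp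
        then have "t \<notin> {0..<1 - 1 / real (Suc n)}" for n
          using False less_le_trans by (metis atLeastLessThan_iff)
        then show ?thesis using False by (intro always_eventually allI) simp
      qed
    qed
  qed
  moreover have "ennreal (d - \<delta>) < (\<integral>\<^sup>+t. ennreal (q t) * indicator {0..<1} t \<partial>lborel)"
    using False \<open>0 < \<delta>\<close> by (intro less_le_trans[OF _ d]) (simp add: ennreal_less_iff)
  ultimately have "eventually (\<lambda>n. ennreal (d - \<delta>) < (\<integral>\<^sup>+t. ?f n t \<partial>lborel)) sequentially"
    by (rule order_tendstoD)
  then show ?thesis
  proof eventually_elim
    case (elim n)
    also have "(\<integral>\<^sup>+t. ?f n t \<partial>lborel) \<le> ennreal ((\<Sum>k<Suc n. q (real k / real (Suc n))) / real (Suc n))"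
      by (rule lower_sum_ge_truncated_integral[OF q nonneg mono]) simp
    finally have "d - \<delta> < (\<Sum>k<Suc n. q (real k / real (Suc n))) / real (Suc n)"
      using False by (simp add: ennreal_less_iff del: sum.lessThan_Suc)
    then show ?case by linarith
  qed
qed

section \<open>Conditional means have smaller risk\<close>

lemma empirical_eqI:
  assumes "1 \<le> N" and f: "\<And>i. i \<in> {1..N} \<Longrightarrow> f i \<in> space S" and "sets P = sets S"
    and "\<And>A. A \<in> sets S \<Longrightarrow> emeasure P A = ennreal (1 / real N) * (\<Sum>i\<in>{1..N}. indicator A (f i))"
  shows "P = empirical S N f"
proof (rule measure_eqI)
  show "sets P = sets (empirical S N f)" using assms(3) by (simp add: empirical_def)
  fix A assume "A \<in> sets P"
  then have A: "A \<in> sets S" using assms(3) by simp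
  show "emeasure P A = emeasure (empirical S N f) A"
    by (simp only: assms(4)[OF A] emeasure_empirical[OF assms(1) f A] sum_distrib_left)
qed

lemma image_cyclic_shift:
  assumes "r < (n::nat)"
  shows "(\<lambda>s. (r + s) mod n) ` {..<n} = {..<n}"
proof
  show "{..<n} \<subseteq> (\<lambda>s. (r + s) mod n) ` {..<n}"
  proof
    fix k assume "k \<in> {..<n}"
    then have "(r + (k + (n - r)) mod n) mod n = k"
      using assms by (simp add: mod_simps)
    then show "k \<in> (\<lambda>s. (r + s) mod n) ` {..<n}"
      using assms by (intro image_eqI[of _ _ "(k + (n - r)) mod n"]) auto
  qed
qed (use assms in auto)

lemma bij_betw_cyclic_shift:
  assumes "r < (n::nat)"
  shows "bij_betw (\<lambda>s. (r + s) mod n) {..<n} {..<n}"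
  by (simp add: bij_betw_def image_cyclic_shift[OF assms] eq_card_imp_inj_on)

text \<open>
  Cell \<open>a * n + r\<close> is the \<open>r\<close>-th cell of block \<open>a\<close>; every block of \<open>n\<close> cells is rotated by \<open>s\<close>.
\<close>
lemma bij_betw_block_shift:
  assumes s: "s < (n::nat)"
  shows "bij_betw (\<lambda>c. c div n * n + (c mod n + s) mod n) {..<N * n} {..<N * n}"
proof -
  let ?f = "\<lambda>c. c div n * n + (c mod n + s) mod n"
  have n: "0 < n" using s by simp
  have div: "c div n < N" if "c < N * n" for c
    using that n by (simp add: less_mult_imp_div_less)
  have block: "a * n + b < N * n" if "a < N" "b < n" for a b
  proof -
    have "a * n + b < Suc a * n" using that by simp
    also have "\<dots> \<le> N * n" using that by (intro mult_le_mono1) simp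
    finally show ?thesis .
  qed
  have "?f ` {..<N * n} = {..<N * n}"
  proof
    show "?f ` {..<N * n} \<subseteq> {..<N * n}" using block div n by auto
    show "{..<N * n} \<subseteq> ?f ` {..<N * n}"
    proof
      fix c assume c: "c \<in> {..<N * n}"
      have "c mod n \<in> (\<lambda>r. (s + r) mod n) ` {..<n}"
        unfolding image_cyclic_shift[OF s] using n by simp
      then obtain r where r: "r < n" "(s + r) mod n = c mod n" by auto
      have "?f (c div n * n + r) = c" using r by (simp add: add.commute)
      then show "c \<in> ?f ` {..<N * n}"
        using c r block div by (intro image_eqI[of _ _ "c div n * n + r"]) auto
    qed
  qed
  then show ?thesis by (simp add: bij_betw_def eq_card_imp_inj_on)
qed

context law_invariant_coherent_risk_measure
begin

lemma nonneg_rvI: "X \<in> borel_measurable M \<Longrightarrow> (\<And>w. w \<in> space M \<Longrightarrow> 0 \<le> X w) \<Longrightarrow> X \<in> nonneg_rv M"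
  by (simp add: nonneg_rv_def)

lemma risk_of_law_distr: "X \<in> nonneg_rv M \<Longrightarrow> risk_of_law M \<rho> (distr M borel X) = \<rho> X"
  unfolding risk_of_law_def by (rule the_equality) (auto intro: law_invariant)

lemma risk_sum:
  assumes "finite S" "\<And>s. s \<in> S \<Longrightarrow> X s \<in> nonneg_rv M"
  shows "\<rho> (\<lambda>w. \<Sum>s\<in>S. X s w) \<le> (\<Sum>s\<in>S. \<rho> (X s))"
  using assms
proof (induction S rule: finite_induct)
  case empty
  then show ?case by (simp add: zero)
next
  case (insert s S)
  have "\<rho> (\<lambda>w. X s w + (\<Sum>s\<in>S. X s w)) \<le> \<rho> (X s) + \<rho> (\<lambda>w. \<Sum>s\<in>S. X s w)"
    using insert.prems by (intro subadditive) (auto simp: nonneg_rv_def intro!: sum_nonneg borel_measurable_sum)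
  also have "\<dots> \<le> \<rho> (X s) + (\<Sum>s\<in>S. \<rho> (X s))"
    using insert by (intro add_mono) auto
  finally show ?case using insert.hyps by simp
qed

lemma risk_average:
  assumes S: "finite S" "S \<noteq> {}" and X: "\<And>s. s \<in> S \<Longrightarrow> X s \<in> nonneg_rv M"
    and r: "\<And>s. s \<in> S \<Longrightarrow> \<rho> (X s) = r"
  shows "\<rho> (\<lambda>w. (\<Sum>s\<in>S. X s w) / real (card S)) \<le> r"
proof -
  have c: "0 < real (card S)" using S by (simp add: card_gt_0_iff)
  have "\<rho> (\<lambda>w. 1 / real (card S) * (\<Sum>s\<in>S. X s w)) = ennreal (1 / real (card S)) * \<rho> (\<lambda>w. \<Sum>s\<in>S. X s w)"
    using X c by (intro positively_homogeneous) (auto simp: nonneg_rv_def intro!: sum_nonneg borel_measurable_sum)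
  also have "\<dots> \<le> ennreal (1 / real (card S)) * (\<Sum>s\<in>S. \<rho> (X s))"
    using S X by (intro mult_left_mono risk_sum) auto
  also have "\<dots> = ennreal (1 / real (card S)) * ennreal (real (card S)) * r"
    using r by (simp add: mult.assoc ennreal_of_nat_eq_real_of_nat)
  also have "\<dots> = r" using c by (simp flip: ennreal_mult)
  finally show ?thesis by simp
qed

context
  fixes U :: "'w \<Rightarrow> real"
  assumes U_measurable[measurable]: "U \<in> borel_measurable M"
    and U_nonneg: "\<And>w. 0 \<le> U w" and U_less_1: "\<And>w. U w < 1"
    and U_uniform: "\<And>f. f \<in> borel_measurable borel \<Longrightarrow>
       (\<integral>\<^sup>+w. f (U w) \<partial>M) = (\<integral>\<^sup>+u. f u * indicator {0..<1} u \<partial>lborel)"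
begin

definition cell :: "nat \<Rightarrow> 'w \<Rightarrow> nat" where
  "cell L w = nat \<lfloor>real L * U w\<rfloor>"

lemma measurable_cell[measurable]: "cell L \<in> M \<rightarrow>\<^sub>M count_space UNIV"
  unfolding cell_def by measurable

lemma real_cell: "real (cell L w) = real L * U w - frac (real L * U w)"
  using U_nonneg[of w] by (simp add: cell_def frac_def)

lemma cell_less: "1 \<le> L \<Longrightarrow> cell L w < L"
proof -
  assume "1 \<le> L"
  then have "real L * U w < real L * 1" using U_less_1 by (intro mult_strict_left_mono) auto
  then have "real (cell L w) < real L" using real_cell[of L w] frac_ge_0[of "real L * U w"] by linarith
  then show ?thesis by simp
qed

lemma cell_refine_div: "1 \<le> n \<Longrightarrow> cell (N * n) w div n = cell N w"
  and cell_refine_mod: "1 \<le> n \<Longrightarrow> real (cell (N * n) w mod n) / real n \<le> frac (real N * U w)"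
proof -
  assume n: "1 \<le> n"
  let ?a = "cell N w" and ?c = "cell (N * n) w" and ?v = "real N * U w"
  have a: "real ?a \<le> ?v" "?v < real ?a + 1"
    using real_cell[of N w] frac_ge_0[of ?v] frac_lt_1[of ?v] by linarith+
  have c: "real ?c \<le> real n * ?v" "real n * ?v < real ?c + 1"
    using real_cell[of "N * n" w] frac_ge_0[of "real (N * n) * U w"] frac_lt_1[of "real (N * n) * U w"]
    by (simp_all add: mult.commute mult.left_commute)
  have "real n * real ?a \<le> real n * ?v" "real n * ?v < real n * (real ?a + 1)"
    using a n by (auto intro!: mult_left_mono mult_strict_left_mono)
  with c have "real n * real ?a < real ?c + 1" "real ?c < real n * (real ?a + 1)" by linarith+
  then have "real (n * ?a) < real (?c + 1)" "real ?c < real (n * (?a + 1))"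
    by (simp_all only: of_nat_mult of_nat_add of_nat_1)
  then have "n * ?a \<le> ?c" "?c < n * (?a + 1)" unfolding of_nat_less_iff by auto
  then show div: "?c div n = ?a" by (intro div_nat_eqI) (auto simp: mult.commute)
  have "?c = n * ?a + ?c mod n" using mult_div_mod_eq[of n ?c] by (simp add: div)
  then have "real ?c = real n * real ?a + real (?c mod n)" by (metis of_nat_add of_nat_mult)
  with c have "real (?c mod n) \<le> real n * (?v - real ?a)" by (simp add: algebra_simps)
  also have "?v - real ?a = frac ?v" using real_cell[of N w] by simp
  finally show "real (?c mod n) / real n \<le> frac ?v" using n by (simp add: field_simps)
qed

lemma emeasure_distr_cellwise:
  assumes L: "1 \<le> L" and [measurable]: "\<And>c. h c \<in> borel_measurable borel" "A \<in> sets borel"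
  shows "emeasure (distr M borel (\<lambda>w. h (cell L w) (frac (real L * U w)))) A =
    ennreal (1 / real L) * (\<Sum>c<L. \<integral>\<^sup>+t. indicator A (h c t :: real) * indicator {0..<1} t \<partial>lborel)"
proof -
  have [measurable]: "(\<lambda>w. h (cell L w) (frac (real L * U w))) \<in> borel_measurable M"
    by (rule measurable_compose_countable[OF _ measurable_cell]) measurable
  have [measurable]: "(\<lambda>u. h (nat \<lfloor>real L * u\<rfloor>) (frac (real L * u))) \<in> borel_measurable borel"
    by (rule measurable_compose_countable[where g = "\<lambda>u. nat \<lfloor>real L * u\<rfloor>"]) measurable
  have "emeasure (distr M borel (\<lambda>w. h (cell L w) (frac (real L * U w)))) A =
    (\<integral>\<^sup>+x. indicator A x \<partial>distr M borel (\<lambda>w. h (cell L w) (frac (real L * U w))))" by simp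
  also have "\<dots> = (\<integral>\<^sup>+w. indicator A (h (nat \<lfloor>real L * U w\<rfloor>) (frac (real L * U w))) \<partial>M)"
    by (subst nn_integral_distr) (auto simp: cell_def)
  also have "\<dots> = (\<integral>\<^sup>+u. indicator A (h (nat \<lfloor>real L * u\<rfloor>) (frac (real L * u))) * indicator {0..<1} u \<partial>lborel)"
    by (intro U_uniform) measurable
  also have "\<dots> = ennreal (1 / real L) * (\<Sum>c<L. \<integral>\<^sup>+t. indicator A (h c t) * indicator {0..<1} t \<partial>lborel)"
    by (intro nn_integral_cells[OF L, of "\<lambda>c t. indicator A (h c t)"]) measurable
  finally show ?thesis .
qed

lemma distr_cell:
  assumes L: "1 \<le> L"
  shows "distr M borel (\<lambda>w. x (cell L w) :: real) = empirical borel L (\<lambda>i. x (i - 1))"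
proof (rule empirical_eqI)
  fix A :: "real set"
  assume A: "A \<in> sets borel"
  have "emeasure (distr M borel (\<lambda>w. x (cell L w))) A =
    ennreal (1 / real L) * (\<Sum>c<L. \<integral>\<^sup>+t. indicator A (x c) * indicator {0..<1::real} t \<partial>lborel)"
    using emeasure_distr_cellwise[OF L _ A, of "\<lambda>c _. x c"] by simp
  also have "\<dots> = ennreal (1 / real L) * (\<Sum>c<L. indicator A (x c))"
    by (simp add: nn_integral_cmult)
  finally show "emeasure (distr M borel (\<lambda>w. x (cell L w))) A =
    ennreal (1 / real L) * (\<Sum>i\<in>{1..L}. indicator A (x (i - 1)))"
    by (simp add: sum.atLeast1_atMost_eq)
qed (use L in auto)

text \<open>All cells are equally likely, so relabelling them leaves the law unchanged.\<close>
lemma distr_cell_permute: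
  assumes L: "1 \<le> L" and \<pi>: "bij_betw \<pi> {..<L} {..<L}"
  shows "distr M borel (\<lambda>w. x (\<pi> (cell L w)) :: real) = distr M borel (\<lambda>w. x (cell L w))"
  unfolding distr_cell[OF L, of x]
proof (rule empirical_eqI)
  fix A :: "real set"
  assume A: "A \<in> sets borel"
  have "emeasure (distr M borel (\<lambda>w. x (\<pi> (cell L w)))) A =
    ennreal (1 / real L) * (\<Sum>c<L. indicator A (x (\<pi> c)))"
    using L A unfolding distr_cell[OF L, of "\<lambda>c. x (\<pi> c)"]
    by (simp add: emeasure_empirical sum_distrib_left sum.atLeast1_atMost_eq)
  also have "(\<Sum>c<L. indicator A (x (\<pi> c))) = (\<Sum>c<L. indicator A (x c) :: ennreal)"
    by (rule sum.reindex_bij_betw[OF \<pi>])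
  finally show "emeasure (distr M borel (\<lambda>w. x (\<pi> (cell L w)))) A =
    ennreal (1 / real L) * (\<Sum>i\<in>{1..L}. indicator A (x (i - 1)))"
    by (simp add: sum.atLeast1_atMost_eq)
qed (use L in auto)

text \<open>
  The average over the \<open>n\<close> rotations of the blocks visits every cell of the block once, so it is
  the block average; the rotated variables all have the same law, hence the same risk.
\<close>
lemma risk_block_average:
  assumes N: "1 \<le> N" and n: "1 \<le> n" and nonneg: "\<And>c. 0 \<le> x c"
  shows "\<rho> (\<lambda>w. (\<Sum>k<n. x (cell N w * n + k)) / real n) \<le> \<rho> (\<lambda>w. x (cell (N * n) w))"
proof -
  define \<pi> where "\<pi> s c = c div n * n + (c mod n + s) mod n" for s c
  have L: "1 \<le> N * n" using N n by simp
  have rv: "(\<lambda>w. y (cell L w)) \<in> nonneg_rv M" if "\<And>c. 0 \<le> y c" for y :: "nat \<Rightarrow> real" and L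
    by (rule nonneg_rvI) (auto simp: that)
  have "\<rho> (\<lambda>w. (\<Sum>s<n. x (\<pi> s (cell (N * n) w))) / real (card {..<n})) \<le> \<rho> (\<lambda>w. x (cell (N * n) w))"
  proof (rule risk_average)
    fix s assume s: "s \<in> {..<n}"
    show "\<rho> (\<lambda>w. x (\<pi> s (cell (N * n) w))) = \<rho> (\<lambda>w. x (cell (N * n) w))"
      using s nonneg unfolding \<pi>_def
      by (intro law_invariant rv[of "\<lambda>c. x (c div n * n + (c mod n + s) mod n)"] rv
            distr_cell_permute[OF L] bij_betw_block_shift) auto
  qed (use n nonneg rv[of "\<lambda>c. x (\<pi> s c)" for s] in \<open>auto simp: lessThan_empty_iff\<close>)
  moreover have "(\<Sum>s<n. x (\<pi> s (cell (N * n) w))) = (\<Sum>k<n. x (cell N w * n + k))" for w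
    unfolding \<pi>_def cell_refine_div[OF n]
    using n by (intro sum.reindex_bij_betw[OF bij_betw_cyclic_shift, of "cell (N * n) w mod n" n "\<lambda>k. x (cell N w * n + k)"]) auto
  ultimately show ?thesis by simp
qed

text \<open>
  The comparison on the probability space itself: \<open>d i\<close> is at most the mean of \<open>q i\<close>, and
  \<open>q (cell N w)\<close> evaluated at the position within the cell realises the mixture of the laws
  with rearrangements \<open>q i\<close>.
\<close>
lemma risk_of_law_conditional_means_aux:
  assumes N: "1 \<le> N"
    and q[measurable]: "\<And>i. q i \<in> borel_measurable borel" and q_nonneg: "\<And>i t. 0 \<le> q i t"
    and q_mono: "\<And>i. mono_on {0..<1} (q i)"
    and d_nonneg: "\<And>i. i < N \<Longrightarrow> 0 \<le> d i"
    and d: "\<And>i. i < N \<Longrightarrow> ennreal (d i) \<le> (\<integral>\<^sup>+t. ennreal (q i t) * indicator {0..<1} t \<partial>lborel)"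
  shows "\<rho> (\<lambda>w. d (cell N w)) \<le> \<rho> (\<lambda>w. q (cell N w) (frac (real N * U w)))"
proof (rule ennreal_le_epsilon)
  fix \<delta> :: real
  assume "0 < \<delta>"
  \<comment> \<open>One mesh \<open>n\<close> serves all \<open>N\<close> conditional laws.\<close>
  have "eventually (\<lambda>n. \<forall>i\<in>{..<N}. d i \<le> (\<Sum>k<Suc n. q i (real k / real (Suc n))) / real (Suc n) + \<delta>) sequentially"
    using d \<open>0 < \<delta>\<close>
    by (intro eventually_ball_finite ballI eventually_lower_sum_ge[OF q q_nonneg q_mono]) auto
  then obtain m where m: "\<And>i. i < N \<Longrightarrow> d i \<le> (\<Sum>k<Suc m. q i (real k / real (Suc m))) / real (Suc m) + \<delta>"
    by (auto simp: eventually_sequentially simp del: sum.lessThan_Suc)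
  define n where "n = Suc m"
  have n: "1 \<le> n" by (simp add: n_def)
  \<comment> \<open>The step function below the cost: \<open>q\<close> at the left end of each cell.\<close>
  define x where "x c = q (c div n) (real (c mod n) / real n)" for c
  have x_nonneg: "0 \<le> x c" for c by (simp add: x_def q_nonneg)
  have x_block: "(\<Sum>k<n. x (i * n + k)) = (\<Sum>k<n. q i (real k / real n))" for i
    by (intro sum.cong) (auto simp: x_def)
  let ?Z = "\<lambda>w. (\<Sum>k<n. x (cell N w * n + k)) / real n"
  have Z: "?Z \<in> nonneg_rv M"
    using x_nonneg by (intro nonneg_rvI) (auto intro!: divide_nonneg_nonneg sum_nonneg)
  have "\<rho> (\<lambda>w. d (cell N w)) \<le> \<rho> (\<lambda>w. ?Z w + \<delta>)"
  proof (rule mono)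
    show "(\<lambda>w. ?Z w + \<delta>) \<in> nonneg_rv M" using Z \<open>0 < \<delta>\<close> by (auto simp: nonneg_rv_def)
    show "(\<lambda>w. d (cell N w)) \<in> nonneg_rv M" using d_nonneg cell_less[OF N] by (intro nonneg_rvI) auto
    show "d (cell N w) \<le> ?Z w + \<delta>" for w
      unfolding x_block using m[OF cell_less[OF N]] by (simp only: n_def)
  qed
  also have "\<dots> = \<rho> ?Z + ennreal \<delta>" using Z \<open>0 < \<delta>\<close> by (intro translation_invariant) auto
  also have "\<rho> ?Z \<le> \<rho> (\<lambda>w. x (cell (N * n) w))" by (rule risk_block_average[OF N n x_nonneg])
  also have "\<dots> \<le> \<rho> (\<lambda>w. q (cell N w) (frac (real N * U w)))"
  proof (rule mono)
    show "(\<lambda>w. q (cell N w) (frac (real N * U w))) \<in> nonneg_rv M"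
    proof (rule nonneg_rvI)
      show "(\<lambda>w. q (cell N w) (frac (real N * U w))) \<in> borel_measurable M"
        by (rule measurable_compose_countable[OF _ measurable_cell]) measurable
    qed (rule q_nonneg)
    show "(\<lambda>w. x (cell (N * n) w)) \<in> nonneg_rv M" by (intro nonneg_rvI) (auto simp: x_nonneg)
    fix w
    have "real (cell (N * n) w mod n) / real n < 1" using n by simp
    then show "x (cell (N * n) w) \<le> q (cell N w) (frac (real N * U w))"
      unfolding x_def cell_refine_div[OF n]
      using cell_refine_mod[OF n, of N w] frac_lt_1 by (intro mono_onD[OF q_mono]) auto
  qed
  finally show "\<rho> (\<lambda>w. d (cell N w)) \<le> \<rho> (\<lambda>w. q (cell N w) (frac (real N * U w))) + ennreal \<delta>"
    by (simp add: add_right_mono)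
qed

end

text \<open>
  The risk measure is monotone with respect to conditioning on \<open>N\<close> equally likely events: \<open>\<nu> i\<close> is the
  conditional law of a cost with law \<open>\<mu>\<close>, and \<open>d i\<close> is at most its conditional mean. The
  means are compared in \<open>ennreal\<close>, so they may be infinite.
\<close>
proposition risk_of_law_conditional_means:
  assumes N: "1 \<le> N"
    and \<nu>: "\<And>i. i \<in> {1..N} \<Longrightarrow> real_distribution (\<nu> i)" "\<And>i. i \<in> {1..N} \<Longrightarrow> AE x in \<nu> i. 0 \<le> x"
    and \<mu>: "sets \<mu> = sets borel"
      "\<And>A. A \<in> sets borel \<Longrightarrow> emeasure \<mu> A = ennreal (1 / real N) * (\<Sum>i\<in>{1..N}. emeasure (\<nu> i) A)"
    and d_nonneg: "\<And>i. i \<in> {1..N} \<Longrightarrow> 0 \<le> d i"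
    and d: "\<And>i. i \<in> {1..N} \<Longrightarrow> ennreal (d i) \<le> (\<integral>\<^sup>+x. ennreal x \<partial>\<nu> i)"
  shows "risk_of_law M \<rho> (empirical borel N d) \<le> risk_of_law M \<rho> \<mu>"
proof -
  from exists_uniform_variable obtain U where U': "U \<in> borel_measurable M \<and> (\<forall>w. 0 \<le> U w \<and> U w < 1) \<and>
     (\<forall>f\<in>borel_measurable borel. (\<integral>\<^sup>+w. f (U w) \<partial>M) = (\<integral>\<^sup>+u. f u * indicator {0..<1::real} u \<partial>lborel))" ..
  then have U: "U \<in> borel_measurable M" "\<And>w. 0 \<le> U w" "\<And>w. U w < 1"
    "\<And>f. f \<in> borel_measurable borel \<Longrightarrow>
       (\<integral>\<^sup>+w. f (U w) \<partial>M) = (\<integral>\<^sup>+u. f u * indicator {0..<1} u \<partial>lborel)"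
    by blast+
  note [measurable] = U(1) measurable_cell[OF U]
  have "\<forall>i\<in>{1..N}. \<exists>q. increasing_rearrangement (\<nu> i) q"
    using exists_increasing_rearrangement \<nu> by blast
  then obtain r where r: "\<forall>i\<in>{1..N}. increasing_rearrangement (\<nu> i) (r i)"
    by (rule bchoice[THEN exE])
  \<comment> \<open>Cells are numbered from \<open>0\<close>, the laws from \<open>1\<close>.\<close>
  define q where "q c = (if c < N then r (Suc c) else (\<lambda>_. 0))" for c
  have r_Suc: "increasing_rearrangement (\<nu> (Suc c)) (r (Suc c))" if "c < N" for c
    using r that by auto
  have q[measurable]: "q c \<in> borel_measurable borel" and q_nonneg: "0 \<le> q c t"
    and q_mono: "mono_on {0..<1} (q c)" for c t
    using r_Suc[of c] by (auto simp: q_def increasing_rearrangement_def intro: mono_onI)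
  have q_law: "(\<integral>\<^sup>+x. f x \<partial>\<nu> (Suc c)) = (\<integral>\<^sup>+t. f (q c t) * indicator {0..<1} t \<partial>lborel)"
    if "c < N" "f \<in> borel_measurable borel" for c and f :: "real \<Rightarrow> ennreal"
    using r_Suc[OF that(1)] that by (simp add: q_def increasing_rearrangement_def)
  let ?X = "\<lambda>w. q (cell U N w) (frac (real N * U w))" and ?Y = "\<lambda>w. d (Suc (cell U N w))"
  have X: "?X \<in> nonneg_rv M"
  proof (rule nonneg_rvI)
    show "?X \<in> borel_measurable M"
      by (rule measurable_compose_countable[OF _ measurable_cell[OF U]]) measurable
  qed (rule q_nonneg)
  have Y: "?Y \<in> nonneg_rv M"
  proof (rule nonneg_rvI)
    show "?Y \<in> borel_measurable M"
      by (rule measurable_compose[OF measurable_cell[OF U], of "\<lambda>c. d (Suc c)"]) (auto simp: measurable_def)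
  qed (use d_nonneg cell_less[OF U N] in \<open>auto simp: Suc_le_eq\<close>)
  have "distr M borel ?X = \<mu>"
  proof (rule measure_eqI)
    fix A assume "A \<in> sets (distr M borel ?X)"
    then have A: "A \<in> sets borel" by simp
    have "emeasure (distr M borel ?X) A =
      ennreal (1 / real N) * (\<Sum>c<N. \<integral>\<^sup>+t. indicator A (q c t) * indicator {0..<1} t \<partial>lborel)"
      by (rule emeasure_distr_cellwise[OF U N q A])
    also have "\<dots> = ennreal (1 / real N) * (\<Sum>c<N. emeasure (\<nu> (Suc c)) A)"
    proof (intro arg_cong2[of _ _ _ _ "(*)"] refl sum.cong)
      fix c assume "c \<in> {..<N}"
      then have c: "c < N" "real_distribution (\<nu> (Suc c))" using \<nu> by auto
      then have "A \<in> sets (\<nu> (Suc c))" using A by (simp add: real_distribution.events_eq_borel)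
      then show "(\<integral>\<^sup>+t. indicator A (q c t) * indicator {0..<1} t \<partial>lborel) = emeasure (\<nu> (Suc c)) A"
        using q_law[OF c(1), of "indicator A"] A by simp
    qed
    also have "\<dots> = emeasure \<mu> A" using A by (simp add: \<mu>(2) sum.atLeast1_atMost_eq)
    finally show "emeasure (distr M borel ?X) A = emeasure \<mu> A" .
  qed (simp add: \<mu>)
  moreover have "distr M borel ?Y = empirical borel N d"
  proof -
    have "empirical borel N (\<lambda>i. d (Suc (i - 1))) = empirical borel N d"
    proof (rule empirical_eqI[OF N])
      fix A :: "real set" assume "A \<in> sets borel"
      then have "emeasure (empirical borel N (\<lambda>i. d (Suc (i - 1)))) A =
        (\<Sum>i=1..N. ennreal (1 / real N) * indicator A (d (Suc (i - 1))))"
        by (intro emeasure_empirical[OF N]) auto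
      also have "\<dots> = ennreal (1 / real N) * (\<Sum>i=1..N. indicator A (d i))"
        unfolding sum_distrib_left by (intro sum.cong) auto
      finally show "emeasure (empirical borel N (\<lambda>i. d (Suc (i - 1)))) A =
        ennreal (1 / real N) * (\<Sum>i\<in>{1..N}. indicator A (d i))" .
    qed (auto simp: empirical_def)
    then show ?thesis using distr_cell[OF U N, of "\<lambda>c. d (Suc c)"] by simp
  qed
  moreover have "\<rho> ?Y \<le> \<rho> ?X"
  proof (rule risk_of_law_conditional_means_aux[OF U N q q_nonneg q_mono])
    show "0 \<le> d (Suc i)" if "i < N" for i using that d_nonneg by simp
    show "ennreal (d (Suc i)) \<le> (\<integral>\<^sup>+t. ennreal (q i t) * indicator {0..<1} t \<partial>lborel)" if "i < N" for i
      using that d[of "Suc i"] q_law[OF that, of ennreal] by simp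
  qed
  ultimately show ?thesis using risk_of_law_distr[OF X] risk_of_law_distr[OF Y] by simp
qed

lemma risk_const: "0 \<le> c \<Longrightarrow> \<rho> (\<lambda>_. c) = ennreal c"
  using translation_invariant[of "\<lambda>_. 0" c] by (simp add: zero nonneg_rv_def)

text \<open>
  Conditioning on the sure event replaces a cost by its mean, and the risk of a constant is that constant.
\<close>
corollary mean_le_risk_of_law:
  assumes \<mu>: "real_distribution \<mu>" "AE x in \<mu>. 0 \<le> x"
  shows "(\<integral>\<^sup>+x. ennreal x \<partial>\<mu>) \<le> risk_of_law M \<rho> \<mu>"
proof (rule dense_le)
  fix z assume z: "z < (\<integral>\<^sup>+x. ennreal x \<partial>\<mu>)"
  then obtain c where c: "0 \<le> c" "z = ennreal c" by (cases z) auto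
  have "distr M borel (\<lambda>_. c) = empirical borel 1 (\<lambda>_. c)"
    by (rule empirical_eqI) (auto simp: emeasure_distr emeasure_space_1 indicator_def)
  then have "ennreal c = risk_of_law M \<rho> (empirical borel 1 (\<lambda>_. c))"
    using risk_of_law_distr[of "\<lambda>_. c"] risk_const[OF c(1)] c(1) by (simp add: nonneg_rv_def)
  also have "\<dots> \<le> risk_of_law M \<rho> \<mu>"
  proof (rule risk_of_law_conditional_means[of 1 "\<lambda>_. \<mu>"])
    show "sets \<mu> = sets borel" using \<mu>(1) by (simp add: real_distribution.events_eq_borel)
  qed (use \<mu> c z in \<open>auto intro: less_imp_le\<close>)
  finally show "z \<le> risk_of_law M \<rho> \<mu>" by (simp add: c)
qed

end

section \<open>Laws with a finitely supported marginal\<close>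

lemma nn_integral_empirical:
  assumes f: "\<And>i. i \<in> {1..N} \<Longrightarrow> f i \<in> space S" and [measurable]: "g \<in> borel_measurable S"
  shows "(\<integral>\<^sup>+x. g x \<partial>empirical S N f) = ennreal (1 / real N) * (\<Sum>i\<in>{1..N}. g (f i))"
proof -
  have "f \<in> uniform_count_measure {1..N} \<rightarrow>\<^sub>M S"
    using f by (auto simp: measurable_def space_uniform_count_measure sets_uniform_count_measure)
  then have "(\<integral>\<^sup>+x. g x \<partial>empirical S N f) = (\<integral>\<^sup>+i. g (f i) \<partial>uniform_count_measure {1..N})"
    unfolding empirical_def by (rule nn_integral_distr) (simp add: assms(2))
  also have "\<dots> = (\<Sum>i\<in>{1..N}. g (f i) * ennreal (1 / real N))"
    unfolding uniform_count_measure_def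
    by (subst nn_integral_point_measure_finite) (auto simp: mult.commute)
  finally show ?thesis by (simp add: sum_distrib_left mult.commute)
qed

lemma distr_empirical:
  assumes f: "\<And>i. i \<in> {1..N} \<Longrightarrow> f i \<in> space S" and g: "g \<in> S \<rightarrow>\<^sub>M T"
  shows "distr (empirical S N f) T g = empirical T N (\<lambda>i. g (f i))"
proof -
  have "f \<in> uniform_count_measure {1..N} \<rightarrow>\<^sub>M S"
    using f by (auto simp: measurable_def space_uniform_count_measure sets_uniform_count_measure)
  with g show ?thesis unfolding empirical_def by (simp add: distr_distr comp_def)
qed

lemma prob_space_empirical:
  assumes "1 \<le> N" and f: "\<And>i. i \<in> {1..N} \<Longrightarrow> f i \<in> space S"
  shows "prob_space (empirical S N f)"
proof -
  interpret prob_space "uniform_count_measure {1..N}"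
    using assms(1) by (intro prob_space_uniform_count_measure) auto
  show ?thesis
    unfolding empirical_def using f
    by (intro prob_space_distr) (auto simp: measurable_def space_uniform_count_measure sets_uniform_count_measure)
qed

text \<open>
  The extended expectation subtracts the integral of the negative part from that of the
  positive part; \<open>a i\<close> and \<open>b i\<close> are the two integrals under the components of a mixture.
\<close>
lemma ext_expectation_mixture:
  assumes a: "\<And>i. i \<in> I \<Longrightarrow> 0 \<le> a i" and b: "\<And>i. i \<in> I \<Longrightarrow> 0 \<le> b i" and c: "0 \<le> c"
    and "(\<integral>\<^sup>+x. ennreal (f x) \<partial>P) = ennreal c * (\<Sum>i\<in>I. ennreal (a i))"
    and "(\<integral>\<^sup>+x. ennreal (- f x) \<partial>P) = ennreal c * (\<Sum>i\<in>I. ennreal (b i))"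
  shows "ext_expectation P f = ereal (c * (\<Sum>i\<in>I. a i - b i))"
proof -
  have "ext_expectation P f = enn2ereal (ennreal (c * (\<Sum>i\<in>I. a i))) - enn2ereal (ennreal (c * (\<Sum>i\<in>I. b i)))"
    unfolding ext_expectation_def assms(4,5) using a b c by (simp add: sum_ennreal ennreal_mult sum_nonneg)
  also have "\<dots> = ereal (c * (\<Sum>i\<in>I. a i)) - ereal (c * (\<Sum>i\<in>I. b i))"
    using a b c by (simp add: enn2ereal_ennreal mult_nonneg_nonneg sum_nonneg)
  finally show ?thesis by (simp add: sum_subtractf right_diff_distrib)
qed

lemma ext_expectation_empirical:
  assumes f: "\<And>i. i \<in> {1..N} \<Longrightarrow> f i \<in> space S" and [measurable]: "g \<in> borel_measurable S"
  shows "ext_expectation (empirical S N f) g = ereal (1 / real N * (\<Sum>i=1..N. g (f i)))"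
proof -
  have "ext_expectation (empirical S N f) g =
    ereal (1 / real N * (\<Sum>i\<in>{1..N}. max 0 (g (f i)) - max 0 (- g (f i))))"
  proof (rule ext_expectation_mixture)
    have "(\<integral>\<^sup>+x. ennreal (g x) \<partial>empirical S N f) = ennreal (1 / real N) * (\<Sum>i\<in>{1..N}. ennreal (g (f i)))"
      by (rule nn_integral_empirical[OF f]) simp_all
    also have "(\<Sum>i\<in>{1..N}. ennreal (g (f i))) = (\<Sum>i\<in>{1..N}. ennreal (max 0 (g (f i))))"
      by (intro sum.cong) (auto simp: max_def ennreal_neg)
    finally show "(\<integral>\<^sup>+x. ennreal (g x) \<partial>empirical S N f) =
      ennreal (1 / real N) * (\<Sum>i\<in>{1..N}. ennreal (max 0 (g (f i))))" .
    have "(\<integral>\<^sup>+x. ennreal (- g x) \<partial>empirical S N f) = ennreal (1 / real N) * (\<Sum>i\<in>{1..N}. ennreal (- g (f i)))"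
      by (rule nn_integral_empirical[OF f]) simp_all
    also have "(\<Sum>i\<in>{1..N}. ennreal (- g (f i))) = (\<Sum>i\<in>{1..N}. ennreal (max 0 (- g (f i))))"
      by (intro sum.cong) (auto simp: max_def ennreal_neg)
    finally show "(\<integral>\<^sup>+x. ennreal (- g x) \<partial>empirical S N f) =
      ennreal (1 / real N) * (\<Sum>i\<in>{1..N}. ennreal (max 0 (- g (f i))))" .
  qed auto
  also have "(\<Sum>i\<in>{1..N}. max 0 (g (f i)) - max 0 (- g (f i))) = (\<Sum>i=1..N. g (f i))"
    by (intro sum.cong) (auto simp: max_def)
  finally show ?thesis .
qed

context
  fixes P :: "('a \<times> 'b) measure" and S :: "'a measure" and N :: nat and x :: "nat \<Rightarrow> 'a"
  assumes P: "prob_space P" and fst_meas[measurable]: "fst \<in> P \<rightarrow>\<^sub>M S"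
    and N: "1 \<le> N" and x: "\<And>i. i \<in> {1..N} \<Longrightarrow> x i \<in> space S"
    and singleton: "\<And>i. i \<in> {1..N} \<Longrightarrow> {x i} \<in> sets S"
    and marginal: "distr P S fst = empirical S N x"
begin

definition fiber :: "nat \<Rightarrow> ('a \<times> 'b) set" where
  "fiber i = {p \<in> space P. fst p = x i}"

text \<open>The mass of \<open>z\<close> under the first marginal; it counts coinciding points.\<close>
definition weight :: "'a \<Rightarrow> ennreal" where
  "weight z = (\<Sum>i\<in>{1..N}. ennreal (1 / real N) * indicator {z} (x i))"

lemma fiber_sets: "i \<in> {1..N} \<Longrightarrow> fiber i \<in> sets P"
  unfolding fiber_def using measurable_sets[OF fst_meas singleton[of i]]
  by (simp add: vimage_def Int_def conj_commute)

lemma emeasure_marginal: "A \<in> sets S \<Longrightarrow>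
    emeasure P {p \<in> space P. fst p \<in> A} = (\<Sum>i\<in>{1..N}. ennreal (1 / real N) * indicator A (x i))"
proof -
  assume A: "A \<in> sets S"
  have "emeasure P {p \<in> space P. fst p \<in> A} = emeasure (distr P S fst) A"
    using A by (subst emeasure_distr) (auto intro!: arg_cong[of _ _ "emeasure P"])
  also have "\<dots> = (\<Sum>i\<in>{1..N}. ennreal (1 / real N) * indicator A (x i))"
    unfolding marginal by (rule emeasure_empirical[OF N x A])
  finally show ?thesis .
qed

lemma emeasure_fiber: "i \<in> {1..N} \<Longrightarrow> emeasure P (fiber i) = weight (x i)"
  unfolding fiber_def weight_def using emeasure_marginal[OF singleton[of i]] by simp

lemma weight_nonzero: "i \<in> {1..N} \<Longrightarrow> weight (x i) \<noteq> 0"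
  unfolding weight_def using N by (auto simp: sum_eq_0_iff indicator_def ennreal_eq_0_iff)

lemma weight_finite: "weight z \<noteq> \<infinity>"
  unfolding weight_def using N by (auto simp: ennreal_mult_eq_top_iff indicator_def)

lemma AE_fst_atom: "AE p in P. fst p \<in> x ` {1..N}"
proof -
  interpret prob_space P by (rule P)
  have "x ` {1..N} = (\<Union>i\<in>{1..N}. {x i})" by auto
  then have A: "x ` {1..N} \<in> sets S" using singleton by auto
  have "emeasure P {p \<in> space P. fst p \<in> x ` {1..N}} = (\<Sum>i\<in>{1..N}. ennreal (1 / real N))"
    unfolding emeasure_marginal[OF A] by (intro sum.cong) auto
  also have "\<dots> = 1" using N by (simp add: ennreal_of_nat_eq_real_of_nat flip: ennreal_mult)
  finally have "prob {p \<in> space P. fst p \<in> x ` {1..N}} = 1" by (simp add: measure_def)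
  from AE_prob_1[OF this] show ?thesis by eventually_elim simp
qed

text \<open>
  Disintegration over a finitely supported marginal. A value taken by several \<open>x i\<close> contributes
  the same conditional law once for each of them; dividing by its weight makes the contributions add up to
  one almost surely.
\<close>
lemma nn_integral_fibers:
  assumes f[measurable]: "f \<in> borel_measurable P"
  shows "(\<integral>\<^sup>+p. f p \<partial>P) = ennreal (1 / real N) * (\<Sum>i\<in>{1..N}. \<integral>\<^sup>+p. f p \<partial>uniform_measure P (fiber i))"
proof -
  have meas: "(\<lambda>p. f p * indicator (fiber i) p) \<in> borel_measurable P" if "i \<in> {1..N}" for i
    using fiber_sets[OF that] by measurable
  have "(\<integral>\<^sup>+p. f p \<partial>P) =
    (\<integral>\<^sup>+p. (\<Sum>i\<in>{1..N}. ennreal (1 / real N) * inverse (weight (x i)) * (f p * indicator (fiber i) p)) \<partial>P)"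
  proof (rule nn_integral_cong_AE)
    have "AE p in P. p \<in> space P" by simp
    with AE_fst_atom show "AE p in P. f p =
      (\<Sum>i\<in>{1..N}. ennreal (1 / real N) * inverse (weight (x i)) * (f p * indicator (fiber i) p))"
    proof eventually_elim
      case (elim p)
      have "(\<Sum>i\<in>{1..N}. ennreal (1 / real N) * inverse (weight (x i)) * (f p * indicator (fiber i) p)) =
        (\<Sum>i\<in>{1..N}. ennreal (1 / real N) * indicator {fst p} (x i) * (inverse (weight (fst p)) * f p))"
        using elim(2) by (intro sum.cong) (auto simp: fiber_def indicator_def mult_ac)
      also have "\<dots> = weight (fst p) * (inverse (weight (fst p)) * f p)"
        by (simp only: weight_def sum_distrib_right)
      also have "\<dots> = weight (fst p) / weight (fst p) * f p" by (simp add: divide_ennreal_def mult.assoc)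
      also have "\<dots> = f p" using elim(1) weight_nonzero weight_finite by (auto simp: ennreal_divide_self top.not_eq_extremum)
      finally show ?case by simp
    qed
  qed
  also have "\<dots> = (\<Sum>i\<in>{1..N}. ennreal (1 / real N) * inverse (weight (x i)) * (\<integral>\<^sup>+p. f p * indicator (fiber i) p \<partial>P))"
    using meas by (subst nn_integral_sum) (auto intro!: sum.cong nn_integral_cmult)
  also have "\<dots> = (\<Sum>i\<in>{1..N}. ennreal (1 / real N) * (\<integral>\<^sup>+p. f p \<partial>uniform_measure P (fiber i)))"
    by (intro sum.cong refl)
      (simp add: nn_integral_uniform_measure fiber_sets emeasure_fiber divide_ennreal_def mult_ac)
  finally show ?thesis by (simp add: sum_distrib_left)
qed

lemma prob_space_fiber: "i \<in> {1..N} \<Longrightarrow> prob_space (uniform_measure P (fiber i))"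
  by (intro prob_space_uniform_measure) (use weight_nonzero weight_finite in \<open>auto simp: emeasure_fiber\<close>)

lemma AE_fiber: "i \<in> {1..N} \<Longrightarrow> AE p in uniform_measure P (fiber i). fst p = x i"
  by (rule AE_uniform_measureI) (auto simp: fiber_sets, simp add: fiber_def)

end

section \<open>From couplings to points and back\<close>

context law_invariant_coherent_risk_measure
begin

text \<open>
  The points are the conditional means of the second component. Jensen's inequality needs an integrable
  loss: the positive part is integrable by linear growth, and if the negative part is not,
  then the extended expectation is \<open>-\<infinity>\<close>.
\<close>
lemma feasible_coupling_dominated_by_points:
  fixes \<Xi> :: "'v::euclidean_space set"
  assumes \<Xi>: "convex \<Xi>" and N: "1 \<le> N" and \<xi>: "\<And>i. i \<in> {1..N} \<Longrightarrow> \<xi>hat i \<in> \<Xi>"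
    and nrm: "is_norm nrm" and l: "concave_on UNIV l"
    and feasible: "P \<in> feasible_couplings M \<rho> nrm \<Xi> N \<xi>hat \<epsilon>"
  shows "\<exists>y\<in>feasible_points M \<rho> nrm \<Xi> N \<xi>hat \<epsilon>.
    ext_expectation P (\<lambda>(x, y). l y) \<le> ereal (1 / real N * (\<Sum>i=1..N. l (y i)))"
proof -
  let ?S = "support_space \<Xi>" and ?d = "\<lambda>(x, y). nrm (x - y)"
  have P: "prob_space P" and sets_P[measurable_cong]: "sets P = sets (?S \<Otimes>\<^sub>M ?S)"
    and marginal: "distr P ?S fst = empirical ?S N \<xi>hat"
    and risk: "transport_risk M \<rho> nrm P \<le> ennreal \<epsilon>"
    using feasible by (auto simp: feasible_couplings_def)
  interpret P: prob_space P by (rule P)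
  have space_P: "space P = \<Xi> \<times> \<Xi>"
    using sets_eq_imp_space_eq[OF sets_P] by (simp add: space_pair_measure space_restrict_space)
  have fst_S[measurable]: "fst \<in> P \<rightarrow>\<^sub>M ?S" and snd_S[measurable]: "snd \<in> P \<rightarrow>\<^sub>M ?S" by measurable
  have embed: "(\<lambda>x. x) \<in> ?S \<rightarrow>\<^sub>M borel" by (rule measurable_restrict_space1) simp
  have [measurable]: "fst \<in> borel_measurable P" "snd \<in> borel_measurable P"
    using measurable_compose[OF fst_S embed] measurable_compose[OF snd_S embed] by simp_all
  have [measurable]: "nrm \<in> borel_measurable borel" "l \<in> borel_measurable borel"
    by (intro borel_measurable_continuous_onI continuous_on_is_norm continuous_on_concave nrm l)+
  have d_meas[measurable]: "?d \<in> borel_measurable P" unfolding case_prod_beta by measurable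
  have d_nonneg: "0 \<le> ?d p" for p using nrm by (cases p) (simp add: is_norm_def)
  have \<xi>_space: "\<And>i. i \<in> {1..N} \<Longrightarrow> \<xi>hat i \<in> space ?S" using \<xi> by (simp add: space_restrict_space)
  have singleton: "{\<xi>hat i} \<in> sets ?S" if "i \<in> {1..N}" for i
    using \<xi>[OF that] unfolding sets_restrict_space by (intro image_eqI[of _ _ "{\<xi>hat i}"]) auto
  note mixture = P fst_S N \<xi>_space singleton marginal
  define Q where "Q i = uniform_measure P (fiber P \<xi>hat i)" for i
  have sets_Q[measurable_cong]: "sets (Q i) = sets P" for i by (simp add: Q_def)
  have prob_Q: "prob_space (Q i)" and AE_Q: "AE p in Q i. fst p = \<xi>hat i" if "i \<in> {1..N}" for i
    unfolding Q_def using prob_space_fiber[OF mixture that] AE_fiber[OF mixture that] by simp_all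
  have P_mixture: "(\<integral>\<^sup>+p. f p \<partial>P) = ennreal (1 / real N) * (\<Sum>i\<in>{1..N}. \<integral>\<^sup>+p. f p \<partial>Q i)"
    if "f \<in> borel_measurable P" for f
    unfolding Q_def by (rule nn_integral_fibers[OF mixture that])
  have finite_Q: "(\<integral>\<^sup>+p. f p \<partial>Q i) < \<infinity>"
    if "f \<in> borel_measurable P" "(\<integral>\<^sup>+p. f p \<partial>P) < \<infinity>" "i \<in> {1..N}" for f i
  proof -
    have "(\<integral>\<^sup>+p. f p \<partial>Q i) \<le> (\<Sum>i\<in>{1..N}. \<integral>\<^sup>+p. f p \<partial>Q i)"
      using that(3) by (intro member_le_sum) auto
    also have "\<dots> = ennreal (real N) * (ennreal (1 / real N) * (\<Sum>i\<in>{1..N}. \<integral>\<^sup>+p. f p \<partial>Q i))"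
      using N by (simp add: mult.assoc[symmetric] flip: ennreal_mult)
    also have "\<dots> = ennreal (real N) * (\<integral>\<^sup>+p. f p \<partial>P)" by (simp only: P_mixture[OF that(1)])
    also have "\<dots> < \<infinity>" using that(2) by (simp add: ennreal_mult_less_top)
    finally show ?thesis .
  qed

  define \<nu> where "\<nu> i = distr (Q i) borel ?d" for i
  let ?\<mu> = "distr P borel ?d"
  have \<mu>: "real_distribution ?\<mu>" "AE x in ?\<mu>. 0 \<le> x"
    using d_nonneg by (auto simp: P.real_distribution_distr AE_distr_iff)
  have \<nu>: "real_distribution (\<nu> i)" "AE x in \<nu> i. 0 \<le> x" if "i \<in> {1..N}" for i
    unfolding \<nu>_def using d_nonneg prob_space.real_distribution_distr[OF prob_Q[OF that]]
    by (auto simp: AE_distr_iff)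
  have \<mu>_mixture: "emeasure ?\<mu> A = ennreal (1 / real N) * (\<Sum>i\<in>{1..N}. emeasure (\<nu> i) A)"
    if A[measurable]: "A \<in> sets borel" for A
  proof -
    have "emeasure (distr R borel ?d) A = (\<integral>\<^sup>+p. indicator A (?d p) \<partial>R)" if [measurable]: "?d \<in> borel_measurable R" for R
    proof -
      have "emeasure (distr R borel ?d) A = (\<integral>\<^sup>+x. indicator A x \<partial>distr R borel ?d)" by simp
      also have "\<dots> = (\<integral>\<^sup>+p. indicator A (?d p) \<partial>R)" by (rule nn_integral_distr) measurable
      finally show ?thesis .
    qed
    note law = this
    have "?d \<in> borel_measurable (Q i)" for i by measurable
    then show ?thesis unfolding \<nu>_def by (simp only: law d_meas) (rule P_mixture, measurable)
  qed

  have risk_\<mu>: "risk_of_law M \<rho> ?\<mu> \<le> ennreal \<epsilon>" using risk by (simp add: transport_risk_def)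
  have "(\<integral>\<^sup>+p. ennreal (?d p) \<partial>P) = (\<integral>\<^sup>+x. ennreal x \<partial>?\<mu>)" by (rule nn_integral_distr[symmetric]) measurable
  also have "\<dots> \<le> ennreal \<epsilon>" using mean_le_risk_of_law[OF \<mu>] risk_\<mu> by (rule order_trans)
  also have "\<dots> < \<infinity>" by simp
  finally have finite_d: "(\<integral>\<^sup>+p. ennreal (?d p) \<partial>P) < \<infinity>" .
  have int_d: "integrable (Q i) ?d" if "i \<in> {1..N}" for i
  proof (rule integrableI_nonneg)
    show "(\<integral>\<^sup>+p. ennreal (?d p) \<partial>Q i) < \<infinity>" by (rule finite_Q[OF _ finite_d that]) measurable
  qed (use d_nonneg in auto)

  obtain c where c: "0 \<le> c" "\<And>x. norm x \<le> c * nrm x" using is_norm_dominates[OF nrm] by auto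
  have int_snd: "integrable (Q i) snd" if i: "i \<in> {1..N}" for i
  proof (rule Bochner_Integration.integrable_bound)
    interpret Q: prob_space "Q i" by (rule prob_Q[OF i])
    show "integrable (Q i) (\<lambda>p. norm (\<xi>hat i) + c * ?d p)"
      by (intro Bochner_Integration.integrable_add integrable_mult_right int_d[OF i]) simp
    show "AE p in Q i. norm (snd p) \<le> norm (norm (\<xi>hat i) + c * ?d p)"
      using AE_Q[OF i]
    proof eventually_elim
      case (elim p)
      have "snd p = fst p - (fst p - snd p)" by simp
      then have "norm (snd p) \<le> norm (fst p) + norm (fst p - snd p)" using norm_triangle_ineq4 by metis
      also have "\<dots> \<le> norm (\<xi>hat i) + c * ?d p" using c(2)[of "fst p - snd p"] elim by (simp add: case_prod_beta)
      finally show ?case by simp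
    qed
  qed measurable
  define y where "y i = (\<integral>p. snd p \<partial>Q i)" for i
  have y_in: "y i \<in> \<Xi>" if i: "i \<in> {1..N}" for i
    unfolding y_def
  proof (rule expectation_in_convex[OF prob_Q[OF i] int_snd[OF i] \<Xi>])
    have space_Q: "space (Q i) = \<Xi> \<times> \<Xi>"
      by (rule trans[OF sets_eq_imp_space_eq[OF sets_Q] space_P])
    show "AE p in Q i. snd p \<in> \<Xi>"
    proof (rule AE_I2)
      fix p assume "p \<in> space (Q i)"
      then show "snd p \<in> \<Xi>" unfolding space_Q by (rule SigmaE) simp
    qed
  qed

  \<comment> \<open>Jensen's inequality for the norm, applied to the displacement from the reference point.\<close>
  have nrm_y: "ennreal (nrm (\<xi>hat i - y i)) \<le> (\<integral>\<^sup>+x. ennreal x \<partial>\<nu> i)" if i: "i \<in> {1..N}" for i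
  proof -
    interpret Q: prob_space "Q i" by (rule prob_Q[OF i])
    have eq: "AE p in Q i. nrm (\<xi>hat i - snd p) = ?d p"
      using AE_Q[OF i] by eventually_elim (simp add: case_prod_beta)
    have int: "integrable (Q i) (\<lambda>p. nrm (\<xi>hat i - snd p))"
    proof (rule Bochner_Integration.integrable_cong_AE_imp[OF int_d[OF i]])
      show "AE p in Q i. ?d p = nrm (\<xi>hat i - snd p)" using eq by eventually_elim simp
    qed measurable
    have "(\<integral>p. - nrm (\<xi>hat i - snd p) \<partial>Q i) \<le> - nrm (\<integral>p. \<xi>hat i - snd p \<partial>Q i)"
    proof (rule jensen_concave[where S = UNIV])
      show "concave_on UNIV (\<lambda>x. - nrm x)" using is_norm_convex[OF nrm] by (simp add: concave_on_def)
    qed (use int int_snd[OF i] Q.prob_space_axioms in auto)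
    moreover have "(\<integral>p. \<xi>hat i - snd p \<partial>Q i) = \<xi>hat i - y i"
      using int_snd[OF i] by (simp add: y_def Q.prob_space)
    moreover have "(\<integral>p. nrm (\<xi>hat i - snd p) \<partial>Q i) = (\<integral>p. ?d p \<partial>Q i)"
      by (rule integral_cong_AE) (use eq in auto)
    ultimately have "nrm (\<xi>hat i - y i) \<le> (\<integral>p. ?d p \<partial>Q i)" by simp
    then have "ennreal (nrm (\<xi>hat i - y i)) \<le> ennreal (\<integral>p. ?d p \<partial>Q i)" by (rule ennreal_leI)
    also have "\<dots> = (\<integral>\<^sup>+p. ennreal (?d p) \<partial>Q i)"
      by (rule nn_integral_eq_integral[symmetric]) (use int_d[OF i] d_nonneg in auto)
    also have "\<dots> = (\<integral>\<^sup>+x. ennreal x \<partial>\<nu> i)" unfolding \<nu>_def by (rule nn_integral_distr[symmetric]) measurable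
    finally show ?thesis .
  qed

  have "distr (empirical (?S \<Otimes>\<^sub>M ?S) N (\<lambda>i. (\<xi>hat i, y i))) borel ?d = empirical borel N (\<lambda>i. ?d (\<xi>hat i, y i))"
  proof (rule distr_empirical)
    show "?d \<in> borel_measurable (?S \<Otimes>\<^sub>M ?S)" using d_meas by (simp cong: measurable_cong_sets add: measurable_cong_sets[OF sets_P refl])
  qed (use \<xi> y_in in \<open>auto simp: space_pair_measure space_restrict_space\<close>)
  then have "transport_risk M \<rho> nrm (empirical (?S \<Otimes>\<^sub>M ?S) N (\<lambda>i. (\<xi>hat i, y i))) =
    risk_of_law M \<rho> (empirical borel N (\<lambda>i. nrm (\<xi>hat i - y i)))"
    by (simp add: transport_risk_def)
  also have "\<dots> \<le> risk_of_law M \<rho> ?\<mu>"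
  proof (rule risk_of_law_conditional_means[OF N \<nu> _ \<mu>_mixture])
    show "0 \<le> nrm (\<xi>hat i - y i)" for i using nrm by (simp add: is_norm_def)
  qed (use nrm_y in auto)
  also note risk_\<mu>
  finally have y_feasible: "y \<in> feasible_points M \<rho> nrm \<Xi> N \<xi>hat \<epsilon>"
    using y_in by (simp add: feasible_points_def)

  let ?l = "\<lambda>(x, y). l y"
  have l_meas[measurable]: "?l \<in> borel_measurable P" unfolding case_prod_beta by measurable
  have upper: "(\<integral>\<^sup>+p. ennreal (?l p) \<partial>Q i) < \<infinity>" if i: "i \<in> {1..N}" for i
  proof -
    interpret Q: prob_space "Q i" by (rule prob_Q[OF i])
    obtain C where C: "0 \<le> C" "\<And>x. l x \<le> C * (1 + norm x)" using concave_linear_growth[OF l] by auto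
    have int: "integrable (Q i) (\<lambda>p. C * (1 + norm (snd p)))"
      using int_snd[OF i] by auto
    have "(\<integral>\<^sup>+p. ennreal (?l p) \<partial>Q i) \<le> (\<integral>\<^sup>+p. ennreal (C * (1 + norm (snd p))) \<partial>Q i)"
      using C(2) by (intro nn_integral_mono ennreal_leI) (auto simp: case_prod_beta)
    also have "\<dots> = ennreal (\<integral>p. C * (1 + norm (snd p)) \<partial>Q i)"
      using int C(1) by (intro nn_integral_eq_integral) (auto intro!: mult_nonneg_nonneg)
    also have "\<dots> < \<infinity>" by simp
    finally show ?thesis .
  qed
  have "ext_expectation P ?l \<le> ereal (1 / real N * (\<Sum>i=1..N. l (y i)))"
  proof (cases "(\<integral>\<^sup>+p. ennreal (- ?l p) \<partial>P) = \<infinity>")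
    case True
    have "(\<integral>\<^sup>+p. ennreal (?l p) \<partial>P) < \<infinity>"
      using upper by (subst P_mixture) (auto simp: ennreal_mult_less_top)
    then have "ext_expectation P ?l = -\<infinity>"
      using True unfolding ext_expectation_def by (cases "\<integral>\<^sup>+p. ennreal (?l p) \<partial>P") (auto simp: enn2ereal_ennreal)
    then show ?thesis by simp
  next
    case False
    then have finite_l: "(\<integral>\<^sup>+p. ennreal (- ?l p) \<partial>P) < \<infinity>" by (simp add: top.not_eq_extremum)
    have lower: "(\<integral>\<^sup>+p. ennreal (- ?l p) \<partial>Q i) < \<infinity>" if "i \<in> {1..N}" for i
      by (rule finite_Q[OF _ finite_l that]) measurable
    let ?a = "\<lambda>i. enn2real (\<integral>\<^sup>+p. ennreal (?l p) \<partial>Q i)" and ?b = "\<lambda>i. enn2real (\<integral>\<^sup>+p. ennreal (- ?l p) \<partial>Q i)"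
    have "ext_expectation P ?l = ereal (1 / real N * (\<Sum>i\<in>{1..N}. ?a i - ?b i))"
    proof (rule ext_expectation_mixture)
      show "(\<integral>\<^sup>+p. ennreal (?l p) \<partial>P) = ennreal (1 / real N) * (\<Sum>i\<in>{1..N}. ennreal (?a i))"
        using upper by (subst P_mixture) auto
      show "(\<integral>\<^sup>+p. ennreal (- ?l p) \<partial>P) = ennreal (1 / real N) * (\<Sum>i\<in>{1..N}. ennreal (?b i))"
        using lower by (subst P_mixture) auto
    qed auto
    also have "\<dots> \<le> ereal (1 / real N * (\<Sum>i=1..N. l (y i)))"
      unfolding ereal_less_eq
    proof (intro mult_left_mono sum_mono)
      fix i assume i: "i \<in> {1..N}"
      have int: "integrable (Q i) ?l"
        using upper[OF i] lower[OF i] by (simp add: real_integrable_def top.not_eq_extremum)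
      then have "?a i - ?b i = (\<integral>p. ?l p \<partial>Q i)" by (simp add: real_lebesgue_integral_def)
      also have "\<dots> \<le> l (y i)"
        unfolding y_def case_prod_unfold
        by (rule jensen_concave[OF prob_Q[OF i] int_snd[OF i] l]) (use int in \<open>simp_all add: case_prod_unfold\<close>)
      finally show "?a i - ?b i \<le> l (y i)" .
    qed simp
    finally show ?thesis .
  qed
  with y_feasible show ?thesis by blast
qed

text \<open>The coupling is the empirical law of the pairs, whose risk constraint is the same by definition.\<close>
lemma feasible_points_give_coupling:
  fixes \<Xi> :: "'v::euclidean_space set"
  assumes N: "1 \<le> N" and \<xi>: "\<And>i. i \<in> {1..N} \<Longrightarrow> \<xi>hat i \<in> \<Xi>" and l: "concave_on UNIV l"
    and y: "y \<in> feasible_points M \<rho> nrm \<Xi> N \<xi>hat \<epsilon>"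
  shows "\<exists>P\<in>feasible_couplings M \<rho> nrm \<Xi> N \<xi>hat \<epsilon>.
    ext_expectation P (\<lambda>(x, y). l y) = ereal (1 / real N * (\<Sum>i=1..N. l (y i)))"
proof
  let ?S = "support_space \<Xi>" and ?g = "\<lambda>i. (\<xi>hat i, y i)"
  let ?P = "empirical (?S \<Otimes>\<^sub>M ?S) N ?g"
  have g: "?g i \<in> space (?S \<Otimes>\<^sub>M ?S)" if "i \<in> {1..N}" for i
    using y \<xi> that by (auto simp: feasible_points_def space_pair_measure space_restrict_space)
  have "distr ?P ?S fst = empirical ?S N \<xi>hat"
    by (subst distr_empirical[OF g measurable_fst]) simp_all
  then show "?P \<in> feasible_couplings M \<rho> nrm \<Xi> N \<xi>hat \<epsilon>"
    using y prob_space_empirical[OF N g]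
    by (simp add: feasible_couplings_def feasible_points_def) (simp add: empirical_def)
  have embed: "(\<lambda>x. x) \<in> ?S \<rightarrow>\<^sub>M borel" by (rule measurable_restrict_space1) simp
  have [measurable]: "l \<in> borel_measurable ?S"
    by (intro measurable_compose[OF embed] borel_measurable_continuous_onI continuous_on_concave l)
  have "(\<lambda>(x, y). l y) \<in> borel_measurable (?S \<Otimes>\<^sub>M ?S)" unfolding case_prod_beta by measurable
  from ext_expectation_empirical[OF g this]
  show "ext_expectation ?P (\<lambda>(x, y). l y) = ereal (1 / real N * (\<Sum>i=1..N. l (y i)))" by simp
qed

end

theorem theorem1:
  fixes \<Xi> :: "(real ^ 'm) set"
    and \<xi>hat :: "nat \<Rightarrow> real ^ 'm"
    and N :: nat
    and \<epsilon> :: real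
    and nrm :: "real ^ 'm \<Rightarrow> real"
    and M :: "'w measure"
    and \<rho> :: "('w \<Rightarrow> real) \<Rightarrow> ennreal"
    and l :: "real ^ 'm \<Rightarrow> real"
  assumes "convex \<Xi>"
    and "N \<ge> 1"
    and "\<And>i. i \<in> {1..N} \<Longrightarrow> \<xi>hat i \<in> \<Xi>"
    and "\<epsilon> \<ge> 0"
    and "is_norm nrm"
    and "law_invariant_coherent_risk_measure M \<rho>"
    and "concave_on UNIV l"
  shows "(SUP P\<in>feasible_couplings M \<rho> nrm \<Xi> N \<xi>hat \<epsilon>. ext_expectation P (\<lambda>(x, y). l y)) =
         (SUP y\<in>feasible_points M \<rho> nrm \<Xi> N \<xi>hat \<epsilon>. ereal (1 / real N * (\<Sum>i=1..N. l (y i))))"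
proof (rule antisym)
  interpret law_invariant_coherent_risk_measure M \<rho> by fact
  show "(SUP P\<in>feasible_couplings M \<rho> nrm \<Xi> N \<xi>hat \<epsilon>. ext_expectation P (\<lambda>(x, y). l y))
    \<le> (SUP y\<in>feasible_points M \<rho> nrm \<Xi> N \<xi>hat \<epsilon>. ereal (1 / real N * (\<Sum>i=1..N. l (y i))))"
    using feasible_coupling_dominated_by_points[OF assms(1-3,5,7)] by (intro SUP_mono) auto
  show "(SUP y\<in>feasible_points M \<rho> nrm \<Xi> N \<xi>hat \<epsilon>. ereal (1 / real N * (\<Sum>i=1..N. l (y i))))
    \<le> (SUP P\<in>feasible_couplings M \<rho> nrm \<Xi> N \<xi>hat \<epsilon>. ext_expectation P (\<lambda>(x, y). l y))"
  proof (rule SUP_mono)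
    fix y assume "y \<in> feasible_points M \<rho> nrm \<Xi> N \<xi>hat \<epsilon>"
    from feasible_points_give_coupling[OF assms(2,3,7) this]
    show "\<exists>P\<in>feasible_couplings M \<rho> nrm \<Xi> N \<xi>hat \<epsilon>. ereal (1 / real N * (\<Sum>i=1..N. l (y i)))
      \<le> ext_expectation P (\<lambda>(x, y). l y)" by force
  qed
qed

end
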